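(* Let $K\in End^*_{\mathcal A}(U)$ and let $\{\Lambda_m\}_{m\in\mathcal M}$, with $\Lambda_m\in End^*_{\mathcal A}(U,V_m)$, be a family such that for any $f\in U$ the mapping $m\mapsto\langle f,\Lambda_mf\rangle$ is measurable on $\mathcal M$. Suppose that the operator $T^*:U\to\bigoplus_{m\in\mathcal M}V_m$ is defined by $T^*f=\{\Lambda_mf\}_{m\in\mathcal M}$ and that $\overline{Ran}(T^* )$ is orthogonally complemented. Then $\{\Lambda_m\}_{m\in\mathcal M}$ is a $c$-$K$-$g$-frame for $U$ with respect to $\{V_m\}_{m\in\mathcal M}$ if and only if there are constants $A,B>0$ such that $$A\|K^*f\|^2\le\left\|\int_{\mathcal M}\langle\Lambda_mf,\Lambda_mf\rangle\,d\mu(m)\right\|\le B\|f\|^2\qquad\text{for all } f\in U.$$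
   Context: $\mathcal A$ is a complex $C^*$-algebra. $U$ and $V$ are (left) Hilbert $\mathcal A$-modules, with $\mathcal A$-valued inner products that are $\mathcal A$-linear in the first variable and norm $\|f\|=\|\langle f,f\rangle\|_{\mathcal A}^{1/2}$. $(\mathcal M,\mu)$ is a measure space with positive measure $\mu$, and $\{V_m\}_{m\in\mathcal M}$ is a family of subspaces of $V$. $End^*_{\mathcal A}(U,V_m)$ is the set of all adjointable $\mathcal A$-linear maps from $U$ into $V_m$, and $End^*_{\mathcal A}(U)=End^*_{\mathcal A}(U,U)$. $\bigoplus_{m\in\mathcal M}V_m$ is the Hilbert $\mathcal A$-module of all families $\{g_m\}_{m\in\mathcal M}$ with $g_m\in V_m$ and $\left\|\int_{\mathcal M}|g_m|^2d\mu(m)\right\|<\infty$, where $|g_m|^2=\langle g_m,g_m\rangle$, with $\mathcal A$-valued inner product $\langle f,g\rangle=\int_{\mathcal M}\langle f_m,g_m\rangle d\mu(m)$ for $f=\{f_m\}_{m\in\mathcal M}$, $g=\{g_m\}_{m\in\mathcal M}$. $T^*$ is the name of the map $f\mapsto\{\Lambda_mf\}_{m\in\mathcal M}$, and $\overline{Ran}(T^* )$ is the closure of its range. A closed submodule $N$ of a Hilbert module $X$ is orthogonally complemented if $X=N\oplus N^\perp$. For $K\in End^*_{\mathcal A}(U)$, a family $\{\Lambda_m\}_{m\in\mathcal M}$ with $\Lambda_m\in End^*_{\mathcal A}(U,V_m)$ is a $c$-$K$-$g$-frame (continuous $K$-$g$-frame) for $U$ with respect to $\{V_m\}_{m\in\mathcal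 M}$ if (i) for all $f\in U$ the mapping $m\mapsto\langle f,\Lambda_mf\rangle$ is measurable on $\mathcal M$, and (ii) there exist constants $A,B>0$ such that $A\langle K^*f,K^*f\rangle\le\int_{\mathcal M}\langle\Lambda_mf,\Lambda_mf\rangle d\mu(m)\le B\langle f,f\rangle$ for all $f\in U$. *)

theory Defs
  imports "HOL-Analysis.Analysis"
begin

section \<open>Complex C*-algebras, not necessarily unital\<close>

class scaleC =
  fixes scaleC :: "complex \<Rightarrow> 'a \<Rightarrow> 'a"  (infixr \<open>*\<^sub>C\<close> 75)

class complex_vector = scaleC + real_vector +
  assumes scaleC_add_right: "c *\<^sub>C (x + y) = c *\<^sub>C x + c *\<^sub>C y"
    and scaleC_add_left: "(c + d) *\<^sub>C x = c *\<^sub>C x + d *\<^sub>C x"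
    and scaleC_scaleC: "c *\<^sub>C (d *\<^sub>C x) = (c * d) *\<^sub>C x"
    and scaleR_eq_scaleC: "r *\<^sub>R x = complex_of_real r *\<^sub>C x"

class complex_normed_vector = complex_vector + real_normed_vector +
  assumes norm_scaleC: "norm (c *\<^sub>C x) = cmod c * norm x"

class cstar_algebra = complex_normed_vector + real_normed_algebra + banach +
  fixes star :: "'a \<Rightarrow> 'a"
  assumes mult_scaleC_left: "(c *\<^sub>C x) * y = c *\<^sub>C (x * y)"
    and mult_scaleC_right: "x * (c *\<^sub>C y) = c *\<^sub>C (x * y)"
    and star_add: "star (x + y) = star x + star y"
    and star_scaleC: "star (c *\<^sub>C x) = cnj c *\<^sub>C star x"
    and star_mult: "star (x * y) = star y * star x"
    and star_star: "star (star x) = x"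
    and cstar_identity: "norm (star x * x) = (norm x)\<^sup>2"

definition cstar_le :: "'a::cstar_algebra \<Rightarrow> 'a \<Rightarrow> bool"  (infix \<open>\<preceq>\<close> 50)
  where "a \<preceq> b \<longleftrightarrow> (\<exists>c. b - a = star c * c)"


section \<open>Hilbert C*-modules and adjointable maps\<close>

locale hilbert_module =
  fixes act :: "'a::cstar_algebra \<Rightarrow> 'x::{complex_normed_vector,banach} \<Rightarrow> 'x"
    and ip :: "'x \<Rightarrow> 'x \<Rightarrow> 'a"
  assumes act_add_right: "act a (f + g) = act a f + act a g"
    and act_add_left: "act (a + b) f = act a f + act b f"
    and act_act: "act a (act b f) = act (a * b) f"
    and act_scaleC_left: "act (c *\<^sub>C a) f = c *\<^sub>C act a f"
    and act_scaleC_right: "act a (c *\<^sub>C f) = c *\<^sub>C act a f"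
    and ip_add_left: "ip (f + g) h = ip f h + ip g h"
    and ip_scaleC_left: "ip (c *\<^sub>C f) g = c *\<^sub>C ip f g"
    and ip_act_left: "ip (act a f) g = a * ip f g"
    and ip_star: "ip g f = star (ip f g)"
    and ip_nonneg: "0 \<preceq> ip f f"
    and norm_eq_sqrt_ip: "norm f = sqrt (norm (ip f f))"

definition submodule :: "('a::cstar_algebra \<Rightarrow> 'x::complex_vector \<Rightarrow> 'x) \<Rightarrow> 'x set \<Rightarrow> bool"
  where "submodule act S \<longleftrightarrow> 0 \<in> S \<and> (\<forall>f\<in>S. \<forall>g\<in>S. f + g \<in> S)
    \<and> (\<forall>c. \<forall>f\<in>S. c *\<^sub>C f \<in> S) \<and> (\<forall>a. \<forall>f\<in>S. act a f \<in> S)"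

definition End_star ::
    "('a::cstar_algebra \<Rightarrow> 'x::complex_vector \<Rightarrow> 'x) \<Rightarrow> ('x \<Rightarrow> 'x \<Rightarrow> 'a)
      \<Rightarrow> 'x set \<Rightarrow> 'x set \<Rightarrow> ('x \<Rightarrow> 'x) set"
  where "End_star act ip S T = {L. (\<forall>f\<in>S. L f \<in> T)
    \<and> (\<forall>f\<in>S. \<forall>g\<in>S. L (f + g) = L f + L g)
    \<and> (\<forall>c. \<forall>f\<in>S. L (c *\<^sub>C f) = c *\<^sub>C L f)
    \<and> (\<forall>a. \<forall>f\<in>S. L (act a f) = act a (L f))
    \<and> (\<exists>L'. (\<forall>g\<in>T. L' g \<in> S) \<and> (\<forall>f\<in>S. \<forall>g\<in>T. ip (L f) g = ip f (L' g)))}"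

text \<open>The adjoint of a map with domain \<open>S\<close>, as a function on its codomain.\<close>

definition adjoint_on :: "('x \<Rightarrow> 'x \<Rightarrow> 'a::cstar_algebra) \<Rightarrow> 'x set \<Rightarrow> ('x \<Rightarrow> 'x) \<Rightarrow> 'x \<Rightarrow> 'x"
  where "adjoint_on ip S L g = (THE u. u \<in> S \<and> (\<forall>f\<in>S. ip (L f) g = ip f u))"


section \<open>Integration of functions with values in a Banach space\<close>

text \<open>
  The integral is the weak (Gelfand-Pettis) one; it agrees with the Bochner integral whenever
  the latter exists. The library's Bochner integral is available for separable spaces only.
  Moreover, under a counting measure Bochner integrability is absolute convergence, whereas
  the standard Hilbert module direct sum asks only that \<open>\<Sum>\<^sub>m \<langle>g\<^sub>m, g\<^sub>m\<rangle>\<close> converge in norm, which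
  for such sums of positive elements is the same as weak integrability.
  Quantifying over real-linear functionals is equivalent to using the complex-linear ones.
\<close>

definition has_weak_integral :: "'m measure \<Rightarrow> ('m \<Rightarrow> 'b::real_normed_vector) \<Rightarrow> 'b \<Rightarrow> bool"
  where "has_weak_integral M F x \<longleftrightarrow>
    (\<forall>\<phi>::'b \<Rightarrow> real. bounded_linear \<phi> \<longrightarrow> has_bochner_integral M (\<lambda>m. \<phi> (F m)) (\<phi> x))"

definition weakly_integrable :: "'m measure \<Rightarrow> ('m \<Rightarrow> 'b::real_normed_vector) \<Rightarrow> bool"
  where "weakly_integrable M F \<longleftrightarrow> (\<exists>x. has_weak_integral M F x)"

definition weak_integral :: "'m measure \<Rightarrow> ('m \<Rightarrow> 'b::real_normed_vector) \<Rightarrow> 'b"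
  where "weak_integral M F = (THE x. has_weak_integral M F x)"

definition strongly_measurable :: "'m measure \<Rightarrow> ('m \<Rightarrow> 'b::real_normed_vector) \<Rightarrow> bool"
  where "strongly_measurable M F \<longleftrightarrow>
    (\<exists>s::nat \<Rightarrow> 'm \<Rightarrow> 'b. (\<forall>i. simple_function M (s i))
      \<and> (\<forall>m\<in>space M. (\<lambda>i. s i m) \<longlonglongrightarrow> F m))"


section \<open>The direct sum of a family of submodules\<close>

text \<open>
  Families are functions on \<open>space M\<close> (their values elsewhere are irrelevant), and almost
  everywhere equal families are to be thought of as identified. Strong measurability makes
  the set of square-integrable families closed under sums and makes \<open>\<langle>g, h\<rangle>\<close> exist: without
  it, \<open>g + h\<close> may have a non-measurable square even though \<open>g\<close> and \<open>h\<close> are square-integrable.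
\<close>

definition hsum ::
    "('x \<Rightarrow> 'x \<Rightarrow> 'a::cstar_algebra) \<Rightarrow> 'm measure \<Rightarrow> ('m \<Rightarrow> 'x::real_normed_vector set)
      \<Rightarrow> ('m \<Rightarrow> 'x) set"
  where "hsum ip M W = {g. (\<forall>m\<in>space M. g m \<in> W m) \<and> strongly_measurable M g
    \<and> weakly_integrable M (\<lambda>m. ip (g m) (g m))}"

definition hsum_ip ::
    "('x \<Rightarrow> 'x \<Rightarrow> 'a::cstar_algebra) \<Rightarrow> 'm measure \<Rightarrow> ('m \<Rightarrow> 'x) \<Rightarrow> ('m \<Rightarrow> 'x) \<Rightarrow> 'a"
  where "hsum_ip ip M g h = weak_integral M (\<lambda>m. ip (g m) (h m))"

definition hsum_norm ::
    "('x \<Rightarrow> 'x \<Rightarrow> 'a::cstar_algebra) \<Rightarrow> 'm measure \<Rightarrow> ('m \<Rightarrow> 'x) \<Rightarrow> real"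
  where "hsum_norm ip M g = sqrt (norm (hsum_ip ip M g g))"

definition hsum_closure ::
    "('x \<Rightarrow> 'x \<Rightarrow> 'a::cstar_algebra) \<Rightarrow> 'm measure \<Rightarrow> ('m \<Rightarrow> 'x::real_normed_vector set)
      \<Rightarrow> ('m \<Rightarrow> 'x) set \<Rightarrow> ('m \<Rightarrow> 'x) set"
  where "hsum_closure ip M W R =
    {g \<in> hsum ip M W. \<forall>\<epsilon>>0. \<exists>h\<in>R. hsum_norm ip M (\<lambda>m. g m - h m) < \<epsilon>}"

definition hsum_perp ::
    "('x \<Rightarrow> 'x \<Rightarrow> 'a::cstar_algebra) \<Rightarrow> 'm measure \<Rightarrow> ('m \<Rightarrow> 'x::real_normed_vector set)
      \<Rightarrow> ('m \<Rightarrow> 'x) set \<Rightarrow> ('m \<Rightarrow> 'x) set"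
  where "hsum_perp ip M W N = {g \<in> hsum ip M W. \<forall>h\<in>N. hsum_ip ip M g h = 0}"

text \<open>
  \<open>X = N \<oplus> N\<^sup>\<bottom>\<close> for a submodule \<open>N\<close> of the direct sum \<open>X\<close>. The intersection of \<open>N\<close> and its
  orthogonal complement consists of null families in any case, so only \<open>X = N + N\<^sup>\<bottom>\<close> is at stake.
\<close>

definition orth_complemented ::
    "('x \<Rightarrow> 'x \<Rightarrow> 'a::cstar_algebra) \<Rightarrow> 'm measure \<Rightarrow> ('m \<Rightarrow> 'x::real_normed_vector set)
      \<Rightarrow> ('m \<Rightarrow> 'x) set \<Rightarrow> bool"
  where "orth_complemented ip M W N \<longleftrightarrow>
    (\<forall>g\<in>hsum ip M W. \<exists>n\<in>N. \<exists>n'\<in>hsum_perp ip M W N. \<forall>m\<in>space M. g m = n m + n' m)"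


section \<open>Continuous K-g-frames\<close>

text \<open>
  The expression \<open>\<langle>f, \<Lambda>\<^sub>m f\<rangle>\<close> pairs \<open>f \<in> U\<close> with an element of \<open>W m \<subseteq> V\<close>, so \<open>U\<close> and \<open>V\<close> are taken
  to be closed submodules of a common Hilbert module on the type \<open>'x\<close>. Unrelated \<open>U\<close> and \<open>V\<close>
  fit in as the summands of \<open>U \<oplus> V\<close>.
\<close>

definition cKg_frame ::
    "('a::cstar_algebra \<Rightarrow> 'x::{complex_normed_vector,banach} \<Rightarrow> 'x) \<Rightarrow> ('x \<Rightarrow> 'x \<Rightarrow> 'a)
      \<Rightarrow> 'm measure \<Rightarrow> 'x set \<Rightarrow> ('m \<Rightarrow> 'x set) \<Rightarrow> ('x \<Rightarrow> 'x) \<Rightarrow> ('m \<Rightarrow> 'x \<Rightarrow> 'x) \<Rightarrow> bool"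
  where "cKg_frame act ip M U W K \<Lambda> \<longleftrightarrow>
    (\<forall>m\<in>space M. \<Lambda> m \<in> End_star act ip U (W m)) \<and>
    (\<forall>f\<in>U. (\<lambda>m. ip f (\<Lambda> m f)) \<in> borel_measurable M) \<and>
    (\<forall>f\<in>U. weakly_integrable M (\<lambda>m. ip (\<Lambda> m f) (\<Lambda> m f))) \<and>
    (\<exists>A>0. \<exists>B>0. \<forall>f\<in>U.
      A *\<^sub>R ip (adjoint_on ip U K f) (adjoint_on ip U K f)
        \<preceq> weak_integral M (\<lambda>m. ip (\<Lambda> m f) (\<Lambda> m f)) \<and>
      weak_integral M (\<lambda>m. ip (\<Lambda> m f) (\<Lambda> m f)) \<preceq> B *\<^sub>R ip f f)"

end

theory Submission
  imports Defs
begin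

text \<open>
  Both inequalities of the frame condition compare the two positive elements
  \<open>p = J f = \<integral>\<langle>\<Lambda>\<^sub>m f, \<Lambda>\<^sub>m f\<rangle>\<close> and \<open>q = \<langle>K\<^sup>* f, K\<^sup>* f\<rangle>\<close> (or \<open>\<langle>f, f\<rangle>\<close> and \<open>J f\<close>). Replacing \<open>f\<close> by \<open>a f\<close>
  replaces \<open>p\<close> and \<open>q\<close> by \<open>a p a\<^sup>*\<close> and \<open>a q a\<^sup>*\<close>, so norm inequalities on all of \<open>U\<close> say that
  \<open>\<parallel>a q a\<^sup>*\<parallel> \<le> C \<parallel>a p a\<^sup>*\<parallel>\<close> for all \<open>a\<close>; with \<open>a\<close> close to \<open>p\<^bsup>-1/2\<^esup>\<close> this gives \<open>q \<preceq> C p\<close>.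

  The order on a C*-algebra is controlled through its unitization, where \<open>h\<close> is positive iff
  \<open>\<parallel>t - h\<parallel> \<le> t\<close> for some \<open>t\<close>: the binomial series then provides a square root. That the weak integral
  of a positive function is positive follows by separating points from the closed positive cone.
\<close>

section \<open>The involution\<close>

lemma scaleC_zero_right [simp]: "c *\<^sub>C (0::'a::complex_vector) = 0"
  using scaleC_add_right[of c 0 0] by simp

lemma scaleC_minus1: "(-1) *\<^sub>C x = - (x::'a::complex_vector)"
  using scaleR_eq_scaleC[of "-1" x] by simp

lemma scaleC_one [simp]: "1 *\<^sub>C x = (x::'a::complex_vector)"
  using scaleR_eq_scaleC[of 1 x] by simp

lemma scaleC_zero_left [simp]: "0 *\<^sub>C x = (0::'a::complex_vector)"
  using scaleR_eq_scaleC[of 0 x] by simp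

lemma scaleC_minus_right: "c *\<^sub>C (- x) = - (c *\<^sub>C (x::'a::complex_vector))"
  using scaleC_add_right[of c x "- x"] by (simp add: add_eq_0_iff)

lemma scaleC_minus_left: "(- c) *\<^sub>C x = - (c *\<^sub>C (x::'a::complex_vector))"
  using scaleC_add_left[of c "- c" x] by (simp add: add_eq_0_iff)

lemma scaleC_diff_right: "c *\<^sub>C (x - y) = c *\<^sub>C x - c *\<^sub>C (y::'a::complex_vector)"
  using scaleC_add_right[of c x "- y"] by (simp add: scaleC_minus_right)

lemma scaleR_scaleC: "r *\<^sub>R (c *\<^sub>C x) = c *\<^sub>C (r *\<^sub>R (x::'a::complex_vector))"
  by (simp add: scaleR_eq_scaleC scaleC_scaleC mult.commute)

lemma star_zero [simp]: "star (0::'a::cstar_algebra) = 0"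
  using star_add[of "0::'a" 0] by simp

lemma star_scaleR: "star (r *\<^sub>R x) = r *\<^sub>R star (x::'a::cstar_algebra)"
  by (simp add: scaleR_eq_scaleC star_scaleC)

lemma star_minus: "star (- x) = - star (x::'a::cstar_algebra)"
  using star_scaleR[of "-1" x] by simp

lemma star_diff: "star (x - y) = star x - star (y::'a::cstar_algebra)"
  using star_add[of x "- y"] by (simp add: star_minus)

lemmas star_simps = star_add star_minus star_diff star_scaleR star_mult star_star

text \<open>The C*-identity and submultiplicativity bound the square of \<open>norm y\<close> by
  \<open>norm (star y) * norm y\<close>; cancel, then apply this to \<open>star x\<close> as
  well.\<close>

lemma norm_star [simp]: "norm (star x) = norm (x::'a::cstar_algebra)"
proof -
  have le: "norm y \<le> norm (star y)" for y :: 'a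
  proof (cases "y = 0")
    case False
    have "(norm y)\<^sup>2 \<le> norm (star y) * norm y"
      using norm_mult_ineq[of "star y" y] by (simp add: cstar_identity)
    with False show ?thesis by (simp add: power2_eq_square)
  qed simp
  from le[of x] le[of "star x"] show ?thesis by (simp add: star_star)
qed

lemma cstar_identity': "norm (x * star x) = (norm (x::'a::cstar_algebra))\<^sup>2"
  using cstar_identity[of "star x"] by (simp add: star_star)

lemma cstar_identity_hermitian:
  "star x = x \<Longrightarrow> norm (x * x) = (norm (x::'a::cstar_algebra))\<^sup>2"
  using cstar_identity[of x] by simp

lemma bounded_linear_star: "bounded_linear (star :: 'a::cstar_algebra \<Rightarrow> 'a)"
  by (rule bounded_linear_intro[where K = 1]) (auto simp: star_add star_scaleR)


section \<open>Square roots in unital C*-algebras\<close>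

text \<open>Taylor coefficients of \<open>sqrt (1 - x)\<close> at 0.\<close>

definition sqrt_coeff :: "nat \<Rightarrow> real"
  where "sqrt_coeff n = (-1) ^ n * ((1/2) gchoose n)"

lemma sqrt_coeff_pochhammer: "sqrt_coeff n = pochhammer (-1/2) n / fact n"
  by (simp add: sqrt_coeff_def gbinomial_pochhammer flip: mult.assoc power_mult_distrib)

text \<open>All coefficients after the first are nonpositive, so an absolute partial sum is 2 minus
  the signed one. The latter has the closed form \<open>(-1) ^ m * ((-1/2) gchoose m)\<close>, which
  is nonnegative.\<close>

lemma sum_sqrt_coeff_le: "(\<Sum>k<n. \<bar>sqrt_coeff k\<bar>) \<le> 2"
proof -
  have neg: "sqrt_coeff (Suc k) \<le> 0" for k
    using pochhammer_nonneg[of "1/2::real" k]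
    by (simp add: sqrt_coeff_pochhammer pochhammer_rec divide_nonpos_pos)
  have abs: "\<bar>sqrt_coeff k\<bar> = (if k = 0 then 2 else 0) - sqrt_coeff k" for k
    using neg[of "k - 1"] by (cases k) (auto simp: sqrt_coeff_def)
  have "(\<Sum>k\<le>m. sqrt_coeff k) = (-1) ^ m * ((-1/2) gchoose m)" for m
    using gbinomial_sum_lower_neg[of "1/2::real" m] by (simp add: sqrt_coeff_def mult.commute)
  also have "\<dots> m = pochhammer (1/2) m / fact m" for m
    by (simp add: gbinomial_pochhammer flip: mult.assoc power_mult_distrib)
  finally have "(\<Sum>k\<le>m. sqrt_coeff k) \<ge> 0" for m
    using pochhammer_nonneg[of "1/2::real" m] by simp
  then have "(\<Sum>k\<le>n. \<bar>sqrt_coeff k\<bar>) \<le> 2"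
    by (simp add: abs sum_subtractf)
  moreover have "(\<Sum>k<n. \<bar>sqrt_coeff k\<bar>) \<le> (\<Sum>k\<le>n. \<bar>sqrt_coeff k\<bar>)"
    by (rule sum_mono2) auto
  ultimately show ?thesis by simp
qed

lemma summable_sqrt_coeff: "summable (\<lambda>n. \<bar>sqrt_coeff n\<bar>)"
  by (rule summableI_nonneg_bounded[OF _ sum_sqrt_coeff_le]) simp

text \<open>Vandermonde's identity for 1/2 + 1/2 = 1: the formal square of the series is
  \<open>1 - x\<close>.\<close>

lemma sqrt_coeff_convolution:
  "(\<Sum>i\<le>n. sqrt_coeff i * sqrt_coeff (n - i)) = (if n = 0 then 1 else if n = 1 then -1 else 0)"
proof -
  have "(\<Sum>i\<le>n. sqrt_coeff i * sqrt_coeff (n - i))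
      = (\<Sum>i\<le>n. (-1) ^ n * (((1/2) gchoose i) * ((1/2) gchoose (n - i))))"
    by (rule sum.cong) (auto simp: sqrt_coeff_def simp flip: power_add)
  also have "\<dots> = (-1) ^ n * ((1::real) gchoose n)"
    using gbinomial_Vandermonde[of "1/2::real" "1/2" n]
    by (simp add: atLeast0AtMost flip: sum_distrib_left)
  also have "(1::real) gchoose n = of_nat (1 choose n)"
    by (metis binomial_gbinomial of_nat_1)
  finally show ?thesis by (cases n) (auto simp: binomial_eq_0)
qed

class cstar_algebra_1 = cstar_algebra + real_normed_algebra_1

lemma star_one [simp]: "star (1::'a::cstar_algebra_1) = 1"
  by (metis mult.right_neutral mult.left_neutral star_mult star_star)

lemma power_star: "star (x ^ n) = star x ^ n" for x :: "'a::cstar_algebra_1"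
  by (induction n) (simp_all add: star_mult power_commutes)

text \<open>Absolute summability of the coefficients makes the binomial series converge on the
  closed unit ball, boundary included. The bound on \<open>1 - s\<close> serves later to show that
  the root is itself positive.\<close>

lemma sqrt_one_minus:
  fixes x :: "'a::cstar_algebra_1"
  assumes "norm x \<le> 1" and "star x = x"
  obtains s where "star s = s" "s * s = 1 - x" "\<And>z. z * x = x * z \<Longrightarrow> z * s = s * z"
    "norm (1 - s) \<le> 1"
proof -
  define a where "a = (\<lambda>n. sqrt_coeff n *\<^sub>R x ^ n)"
  have na: "norm (a n) \<le> \<bar>sqrt_coeff n\<bar>" for n
  proof -
    have "norm (x ^ n) \<le> 1"
      using norm_power_ineq[of x n] power_le_one[of "norm x" n] assms by simp
    then show ?thesis by (simp add: a_def mult_left_le)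
  qed
  then have sn: "summable (\<lambda>n. norm (a n))"
    by (intro summable_comparison_test[OF _ summable_sqrt_coeff]) auto
  then have sa: "summable a" by (rule summable_norm_cancel)
  have "star (suminf a) = suminf a"
    using bounded_linear.suminf[OF bounded_linear_star sa] assms
    by (simp add: a_def star_scaleR power_star)
  moreover have "suminf a * suminf a = 1 - x"
  proof -
    have "(\<lambda>n. \<Sum>i\<le>n. a i * a (n - i)) sums (suminf a * suminf a)"
      by (rule Cauchy_product_sums[OF sn sn])
    also have "(\<lambda>n. \<Sum>i\<le>n. a i * a (n - i))
        = (\<lambda>n. (if n = 0 then 1 else if n = 1 then - x else 0))"
    proof
      fix n
      have "(\<Sum>i\<le>n. a i * a (n - i)) = (\<Sum>i\<le>n. sqrt_coeff i * sqrt_coeff (n - i)) *\<^sub>R x ^ n"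
        by (simp add: scaleR_sum_left a_def mult.commute flip: power_add)
      then show "(\<Sum>i\<le>n. a i * a (n - i)) = (if n = 0 then 1 else if n = 1 then - x else 0)"
        by (simp add: sqrt_coeff_convolution)
    qed
    finally have "suminf a * suminf a = (\<Sum>n. if n = 0 then 1 else if n = 1 then - x else 0)"
      by (rule sums_unique)
    also have "\<dots> = (\<Sum>n\<in>{0, 1::nat}. if n = 0 then 1 else if n = 1 then - x else 0)"
      by (rule suminf_finite) auto
    finally show ?thesis by simp
  qed
  moreover have "norm (1 - suminf a) \<le> 1"
  proof -
    \<comment> \<open>The leading coefficient is 1, so this is minus the tail, whose coefficients
      have absolute sum at most 2 - 1.\<close>
    have "1 - suminf a = - (\<Sum>n. a (Suc n))"
      by (simp add: suminf_split_head[OF sa]) (simp add: a_def sqrt_coeff_def)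
    then have "norm (1 - suminf a) \<le> (\<Sum>n. norm (a (Suc n)))"
      using summable_norm[of "\<lambda>n. a (Suc n)"] summable_Suc_iff[of "\<lambda>n. norm (a n)"] sn by simp
    also have "\<dots> \<le> (\<Sum>n. \<bar>sqrt_coeff (Suc n)\<bar>)"
      using na sn summable_sqrt_coeff
      by (intro suminf_le summable_Suc_iff[of "\<lambda>n. norm (a n)", THEN iffD2]
          summable_Suc_iff[of "\<lambda>n. \<bar>sqrt_coeff n\<bar>", THEN iffD2])
    also have "\<dots> = (\<Sum>n. \<bar>sqrt_coeff n\<bar>) - 1"
      by (simp add: suminf_split_head[OF summable_sqrt_coeff]) (simp add: sqrt_coeff_def)
    also have "\<dots> \<le> 1"
      using suminf_le_const[OF summable_sqrt_coeff sum_sqrt_coeff_le] by simp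
    finally show ?thesis .
  qed
  moreover have "z * suminf a = suminf a * z" if "z * x = x * z" for z
  proof -
    have "z * x ^ n = x ^ n * z" for n
      by (induction n) (simp_all add: that, metis mult.assoc that)
    then have "z * a n = a n * z" for n by (simp add: a_def)
    then show ?thesis using suminf_mult[OF sa, of z] suminf_mult2[OF sa, of z] by simp
  qed
  ultimately show thesis using that by blast
qed

text \<open>Rescaling of \<open>sqrt_one_minus\<close> through \<open>h = t (1 - x)\<close>; the
  norm criterion stands in for a spectral condition.\<close>

lemma sqrt_exists:
  fixes h :: "'a::cstar_algebra_1"
  assumes "star h = h" and t: "norm (t *\<^sub>R 1 - h) \<le> t"
  obtains s where "star s = s" "s * s = h" "\<And>z. z * h = h * z \<Longrightarrow> z * s = s * z"
    "norm (sqrt t *\<^sub>R 1 - s) \<le> sqrt t"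
proof (cases "t = 0")
  case True
  with t have "h = 0" by simp
  then show thesis using that[of 0] True by simp
next
  case False
  with t have "t > 0" using norm_ge_zero[of "t *\<^sub>R 1 - h"] by linarith
  define x where "x = 1 - (1/t) *\<^sub>R h"
  have "t *\<^sub>R 1 - h = t *\<^sub>R x" using \<open>t > 0\<close> by (simp add: x_def algebra_simps)
  with t \<open>t > 0\<close> have "norm x \<le> 1" by simp
  moreover have "star x = x" using assms by (simp add: x_def star_simps)
  ultimately obtain s where s: "star s = s" "s * s = 1 - x"
    "\<And>z. z * x = x * z \<Longrightarrow> z * s = s * z" "norm (1 - s) \<le> 1"
    by (rule sqrt_one_minus) blast
  show thesis
  proof (rule that[of "sqrt t *\<^sub>R s"])
    show "star (sqrt t *\<^sub>R s) = sqrt t *\<^sub>R s" by (simp add: star_simps s)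
    show "(sqrt t *\<^sub>R s) * (sqrt t *\<^sub>R s) = h" using \<open>t > 0\<close> by (simp add: s x_def)
    show "z * (sqrt t *\<^sub>R s) = (sqrt t *\<^sub>R s) * z" if "z * h = h * z" for z
    proof -
      have "z * x = x * z" using that by (simp add: x_def algebra_simps)
      then show ?thesis using s(3) by simp
    qed
    have "norm (sqrt t *\<^sub>R (1 - s)) \<le> sqrt t" using s(4) \<open>t > 0\<close> by (simp add: mult_left_le)
    then show "norm (sqrt t *\<^sub>R 1 - sqrt t *\<^sub>R s) \<le> sqrt t" by (simp add: scaleR_diff_right)
  qed
qed

text \<open>A form of positivity that can be handled without spectral theory. That it covers all
  \<open>star c * c\<close> is the harder fact \<open>square_pos_star_mult\<close>.\<close>

definition square_pos :: "'a::cstar_algebra_1 \<Rightarrow> bool"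
  where "square_pos h \<longleftrightarrow> (\<exists>s. star s = s \<and> h = s * s)"

lemma square_posI: "star s = s \<Longrightarrow> square_pos (s * s)"
  by (auto simp: square_pos_def)

lemma square_pos_hermitian: "square_pos h \<Longrightarrow> star h = h"
  by (auto simp: square_pos_def star_mult)

lemma square_pos_if_norm: "star h = h \<Longrightarrow> norm (t *\<^sub>R 1 - h) \<le> t \<Longrightarrow> square_pos h"
  by (metis sqrt_exists square_posI)

text \<open>Because \<open>s\<close> and \<open>r\<close> commute, \<open>u = s + i r\<close>
  satisfies \<open>star u * u = t\<close>, so its norm is \<open>sqrt t\<close>; its real part
  \<open>s\<close> is no larger.\<close>

lemma norm_square_le_if_circle:
  fixes s r :: "'a::cstar_algebra_1"
  assumes s: "star s = s" and r: "star r = r" and c: "s * r = r * s"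
    and eq: "s * s + r * r = t *\<^sub>R 1" and t: "t \<ge> 0"
  shows "norm (s * s) \<le> t"
proof -
  define u where "u = s + \<i> *\<^sub>C r"
  have su: "star u = s - \<i> *\<^sub>C r"
    by (simp add: u_def star_add star_scaleC s r scaleC_minus_left)
  have "star u * u = t *\<^sub>R 1"
    unfolding su eq[symmetric]
    by (simp add: u_def algebra_simps mult_scaleC_left mult_scaleC_right scaleC_scaleC c scaleC_minus1
        scaleC_diff_right)
  then have nu: "(norm u)\<^sup>2 = t" using cstar_identity[of u] t by simp
  have "2 *\<^sub>R s = u + star u" unfolding su by (simp add: u_def scaleR_2)
  then have "2 * norm s \<le> norm u + norm (star u)"
    using norm_triangle_ineq[of u "star u"] by (metis abs_numeral norm_scaleR)
  then have "norm s \<le> norm u" by simp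
  then have "(norm s)\<^sup>2 \<le> t" using nu by (metis norm_ge_zero power_mono)
  then show ?thesis by (simp add: cstar_identity_hermitian s)
qed

text \<open>Converse of \<open>square_pos_if_norm\<close>. Since \<open>t - g = h\<close> has norm
  at most \<open>t\<close>, \<open>g = t - h\<close> has a root \<open>r\<close>, which commutes
  with the root \<open>s\<close> of \<open>h\<close>; the circle relation bounds
  \<open>r * r = g\<close>.\<close>

lemma square_pos_norm_bound:
  fixes h :: "'a::cstar_algebra_1"
  assumes "square_pos h" and "norm h \<le> t"
  shows "norm (t *\<^sub>R 1 - h) \<le> t"
proof -
  obtain s where s: "star s = s" "h = s * s" using assms by (auto simp: square_pos_def)
  define g where "g = t *\<^sub>R 1 - h"
  have "star g = g" by (simp add: g_def star_simps s)
  moreover have "norm (t *\<^sub>R 1 - g) \<le> t" using assms by (simp add: g_def)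
  ultimately obtain r where r: "star r = r" "r * r = g" "\<And>z. z * g = g * z \<Longrightarrow> z * r = r * z"
    by (rule sqrt_exists) blast
  have "s * g = g * s" by (simp add: g_def s algebra_simps)
  then have "r * s = s * r" using r(3) by simp
  moreover have "r * r + s * s = t *\<^sub>R 1" using r(2) s(2) by (simp add: g_def)
  moreover have "t \<ge> 0" using assms(2) norm_ge_zero order_trans by blast
  ultimately have "norm (r * r) \<le> t" using r(1) s(1) by (intro norm_square_le_if_circle)
  then show ?thesis by (simp add: r g_def)
qed

text \<open>The last bound of \<open>sqrt_exists\<close>, with \<open>t = norm h\<close>, is the
  norm criterion for the root itself.\<close>

lemma square_pos_sqrt:
  fixes h :: "'a::cstar_algebra_1"
  assumes "square_pos h"
  obtains s where "star s = s" "s * s = h" "\<And>z. z * h = h * z \<Longrightarrow> z * s = s * z"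
    "square_pos s"
  by (rule sqrt_exists[OF square_pos_hermitian[OF assms] square_pos_norm_bound[OF assms order_refl]])
     (blast intro: square_pos_if_norm)

text \<open>Under the norm criterion, closure under sums is the triangle inequality.\<close>

lemma square_pos_add:
  assumes "square_pos h" and "square_pos k"
  shows "square_pos (h + k)"
proof (rule square_pos_if_norm)
  show "star (h + k) = h + k" using assms by (simp add: star_add square_pos_hermitian)
  have "norm ((norm h + norm k) *\<^sub>R 1 - (h + k))
      = norm ((norm h *\<^sub>R 1 - h) + (norm k *\<^sub>R 1 - k))" by (simp add: algebra_simps)
  also have "\<dots> \<le> norm h + norm k"
    by (intro norm_triangle_mono square_pos_norm_bound assms order_refl)
  finally show "norm ((norm h + norm k) *\<^sub>R 1 - (h + k)) \<le> norm h + norm k" .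
qed

lemma square_pos_scaleR: "square_pos h \<Longrightarrow> r \<ge> 0 \<Longrightarrow> square_pos (r *\<^sub>R h)"
  unfolding square_pos_def
  by (elim exE, rule_tac x = "sqrt r *\<^sub>R s" in exI) (simp add: star_scaleR)

lemma square_pos_norm_diff:
  fixes h :: "'a::cstar_algebra_1"
  assumes "square_pos h" and "norm h \<le> t"
  shows "square_pos (t *\<^sub>R 1 - h)"
  using assms square_pos_hermitian[OF assms(1)]
  by (intro square_pos_if_norm[of _ t]) (auto simp: star_simps)

text \<open>With \<open>t = norm b\<close>, the element \<open>t - a = (t - b) + (b - a)\<close> is
  positive and has a root commuting with a root of \<open>a\<close>; the circle relation then bounds
  \<open>a\<close>.\<close>

lemma square_pos_norm_mono:
  fixes a b :: "'a::cstar_algebra_1"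
  assumes a: "square_pos a" and b: "square_pos (b - a)"
  shows "norm a \<le> norm b"
proof -
  define t where "t = norm b"
  have "square_pos b" using square_pos_add[OF a b] by simp
  then have "square_pos (t *\<^sub>R 1 - b)" by (simp add: t_def square_pos_norm_diff)
  then have "square_pos (t *\<^sub>R 1 - a)" using square_pos_add[OF _ b] by fastforce
  then obtain r where r: "star r = r" "r * r = t *\<^sub>R 1 - a"
    "\<And>z. z * (t *\<^sub>R 1 - a) = (t *\<^sub>R 1 - a) * z \<Longrightarrow> z * r = r * z"
    by (rule square_pos_sqrt) blast
  obtain s where s: "star s = s" "a = s * s" using a by (auto simp: square_pos_def)
  have "s * (t *\<^sub>R 1 - a) = (t *\<^sub>R 1 - a) * s" by (simp add: s algebra_simps)
  then have "s * r = r * s" by (rule r(3))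
  then have "norm (s * s) \<le> t"
    using r(1,2) s by (intro norm_square_le_if_circle[of s r]) (auto simp: t_def)
  then show ?thesis by (simp add: s t_def)
qed

text \<open>Self-adjointness and the norm criterion with \<open>t = norm h\<close> both pass to
  limits.\<close>

lemma closed_square_pos: "closed {h::'a::cstar_algebra_1. square_pos h}"
  unfolding closed_sequential_limits mem_Collect_eq
proof (intro allI impI, elim conjE)
  fix h :: "nat \<Rightarrow> 'a" and l
  assume h: "\<forall>n. square_pos (h n)" and l: "h \<longlonglongrightarrow> l"
  have "(\<lambda>n. star (h n)) \<longlonglongrightarrow> star l" by (rule bounded_linear.tendsto[OF bounded_linear_star l])
  moreover have "(\<lambda>n. star (h n)) = h" using h by (auto simp: square_pos_hermitian)
  ultimately have "star l = l" using l LIMSEQ_unique by metis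
  moreover have "norm (norm l *\<^sub>R 1 - l) \<le> norm l"
  proof (rule LIMSEQ_le)
    show "(\<lambda>n. norm (norm (h n) *\<^sub>R 1 - h n)) \<longlonglongrightarrow> norm (norm l *\<^sub>R 1 - l)"
      by (intro tendsto_intros l)
    show "(\<lambda>n. norm (h n)) \<longlonglongrightarrow> norm l" by (intro tendsto_intros l)
    show "\<exists>N. \<forall>n\<ge>N. norm (norm (h n) *\<^sub>R 1 - h n) \<le> norm (h n)"
      using h square_pos_norm_bound by blast
  qed
  ultimately show "square_pos l" by (rule square_pos_if_norm)
qed

text \<open>
  If \<open>y = -d\<^sup>*d\<close> were positive of norm 1, then \<open>y + y\<^sup>2 \<ge> 2y\<^sup>2\<close> would have norm at least 2, whereas
  \<open>y + y\<^sup>2 = -d\<^sup>*(1 - dd\<^sup>*)d\<close> has norm at most 1.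
\<close>

lemma eq_zero_if_square_pos_minus_star_mult:
  fixes d :: "'a::cstar_algebra_1"
  assumes pos: "square_pos (- (star d * d))"
  shows "d = 0"
proof (rule ccontr)
  assume "d \<noteq> 0"
  define e where "e = (1 / norm d) *\<^sub>R d"
  have ne: "norm e = 1" using \<open>d \<noteq> 0\<close> by (simp add: e_def)
  define x y where "x = e * star e" and "y = - (star e * e)"
  have "y = (1 / norm d)\<^sup>2 *\<^sub>R (- (star d * d))"
    by (simp add: y_def e_def star_scaleR power2_eq_square)
  then have y: "square_pos y" using square_pos_scaleR[OF pos, of "(1 / norm d)\<^sup>2"] by simp
  have ny: "norm y = 1" by (simp add: y_def cstar_identity ne)
  have nx: "norm x = 1" by (simp add: x_def cstar_identity' ne)
  \<comment> \<open>Real and imaginary parts of \<open>e\<close>: since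
    \<open>e * star e + star e * e\<close> is twice \<open>a * a + b * b\<close>, the element
    \<open>x\<close> is a sum of positive ones.\<close>
  define a b where "a = (1/2) *\<^sub>R (e + star e)" and "b = (\<i> / 2) *\<^sub>C (star e - e)"
  have ab: "star a = a" "star b = b"
    by (simp_all add: a_def b_def star_simps star_scaleC scaleC_minus_left scaleC_diff_right add.commute)
  have "2 *\<^sub>R (a * a) = (1/2) *\<^sub>R ((e + star e) * (e + star e))" by (simp add: a_def)
  moreover have "2 *\<^sub>R (b * b) = - ((1/2) *\<^sub>R ((star e - e) * (star e - e)))"
    by (simp add: b_def mult_scaleC_left mult_scaleC_right scaleC_scaleC scaleR_eq_scaleC scaleC_minus_left
        scaleC_minus_right)
  ultimately have "2 *\<^sub>R (a * a) + 2 *\<^sub>R (b * b) + y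
     = (1/2) *\<^sub>R ((e + star e) * (e + star e) - (star e - e) * (star e - e)) + y"
    by (simp add: scaleR_diff_right)
  also have "(e + star e) * (e + star e) - (star e - e) * (star e - e)
     = 2 *\<^sub>R (e * star e) + 2 *\<^sub>R (star e * e)"
    by (simp add: algebra_simps scaleR_2)
  finally have "2 *\<^sub>R (a * a) + 2 *\<^sub>R (b * b) + y = x"
    by (simp add: x_def y_def scaleR_add_right)
  then have "square_pos x"
    using square_pos_add[OF square_pos_add[OF square_pos_scaleR square_pos_scaleR] y]
      square_posI[OF ab(1)] square_posI[OF ab(2)] by (metis zero_le_numeral)
  then have n1: "norm (1 - x) \<le> 1" using square_pos_norm_bound[of x 1] nx by simp
  have "y + y * y = - (star e * (1 - x) * e)" by (simp add: x_def y_def algebra_simps)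
  then have "norm (y + y * y) = norm (star e * (1 - x) * e)" by simp
  also have "\<dots> \<le> norm (star e) * norm (1 - x) * norm e"
    using order_trans[OF norm_mult_ineq mult_right_mono[OF norm_mult_ineq norm_ge_zero]] .
  also have "\<dots> \<le> 1" using ne n1 by simp
  finally have up: "norm (y + y * y) \<le> 1" .
  \<comment> \<open>The roots of \<open>y\<close> and \<open>1 - y\<close> commute, so
    \<open>y - y * y\<close> is the square of \<open>s * r\<close>; this is the domination of
    \<open>2 y * y\<close> by \<open>y + y * y\<close>.\<close>
  obtain s where s: "star s = s" "s * s = y" using y by (auto simp: square_pos_def)
  have "square_pos (1 - y)" using square_pos_norm_diff[OF y, of 1] ny by simp
  then obtain r where r: "star r = r" "r * r = 1 - y"
    "\<And>z. z * (1 - y) = (1 - y) * z \<Longrightarrow> z * r = r * z" by (rule square_pos_sqrt) blast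
  have "s * (1 - y) = (1 - y) * s" by (simp add: s(2)[symmetric] algebra_simps)
  then have sr: "s * r = r * s" by (rule r(3))
  have "(s * r) * (s * r) = s * (r * r) * s" using sr by (metis mult.assoc)
  also have "\<dots> = y - y * y" by (simp add: r(2) s(2)[symmetric] algebra_simps)
  finally have "square_pos (y - y * y)"
    using square_posI[of "s * r"] sr by (simp add: star_mult s r)
  then have "square_pos ((y + y * y) - 2 *\<^sub>R (y * y))" by (simp add: scaleR_2)
  moreover have "square_pos (2 *\<^sub>R (y * y))"
    using square_posI[OF square_pos_hermitian[OF y]] by (simp add: square_pos_scaleR)
  ultimately have "norm (2 *\<^sub>R (y * y)) \<le> norm (y + y * y)" by (intro square_pos_norm_mono)
  then show False
    using up ny cstar_identity_hermitian[OF square_pos_hermitian[OF y]] by simp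
qed

text \<open>
  With \<open>g\<close> the modulus of \<open>h = c\<^sup>*c\<close> and \<open>k = g - h\<close>, the element \<open>d = ck\<close> satisfies \<open>-d\<^sup>*d = gk\<^sup>2\<close>, so
  \<open>k = 0\<close>. This avoids the decomposition of \<open>h\<close> into positive and negative parts.
\<close>

lemma square_pos_star_mult:
  fixes c :: "'a::cstar_algebra_1"
  shows "square_pos (star c * c)"
proof -
  define h where "h = star c * c"
  have h: "star h = h" by (simp add: h_def star_simps)
  obtain g where g: "star g = g" "g * g = h * h" "\<And>z. z * (h * h) = (h * h) * z \<Longrightarrow> z * g = g * z"
    "square_pos g"
    using square_pos_sqrt[OF square_posI[OF h]] by blast
  have hg: "h * g = g * h" using g(3)[of h] by (simp add: mult.assoc)
  define k where "k = g - h"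
  have k: "star k = k" by (simp add: k_def star_diff g h)
  have "k * g = g * k" by (simp add: k_def algebra_simps hg)
  \<comment> \<open>A root of \<open>g\<close> commuting with \<open>k\<close> exhibits
    \<open>g * k * k\<close> as the square of the self-adjoint \<open>w * k\<close>.\<close>
  then obtain w where w: "star w = w" "w * w = g" "k * w = w * k"
    using square_pos_sqrt[OF g(4)] by metis
  have hk: "h * k = - (g * k)" by (simp add: k_def algebra_simps hg g)
  have "star (c * k) * (c * k) = k * (h * k)" by (simp add: star_mult k h_def mult.assoc)
  also have "\<dots> = - ((w * k) * (w * k))" by (simp add: hk w(2)[symmetric] mult.assoc)
      (metis mult.assoc w(3))
  finally have d: "star (c * k) * (c * k) = - ((w * k) * (w * k))" .
  have wk: "star (w * k) = w * k" by (simp add: star_mult k w)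
  have "c * k = 0" using square_posI[OF wk] d
    by (intro eq_zero_if_square_pos_minus_star_mult) simp
  \<comment> \<open>From \<open>c * k = 0\<close> there vanish in turn \<open>w * k\<close>,
    \<open>g * k\<close>, \<open>h * k\<close> and \<open>k * k = g * k - h * k\<close>, so
    \<open>h = g\<close> is positive.\<close>
  then have "w * k = 0" using d cstar_identity_hermitian[OF wk] by simp
  then have "g * k = 0" by (metis w(2) mult.assoc mult_zero_right)
  then have "k * k = 0" using hk by (simp add: k_def left_diff_distrib)
  then have "k = 0" using cstar_identity_hermitian[OF k] by simp
  then show ?thesis using g(4) by (simp add: k_def h_def)
qed

section \<open>From norm inequalities to order inequalities\<close>

lemma inverse_one_minus_exists:
  fixes y :: "'a::{real_normed_algebra_1, banach}"
  assumes "norm y < 1"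
  obtains z where "(1 - y) * z = 1" "z * (1 - y) = 1"
proof -
  have s: "summable (\<lambda>n. y ^ n)" by (rule complete_algebra_summable_geometric[OF assms])
  have shift: "suminf (\<lambda>n. y ^ n) = 1 + (\<Sum>n. y ^ Suc n)"
    using suminf_split_head[OF s] by simp
  have "y * suminf (\<lambda>n. y ^ n) = (\<Sum>n. y ^ Suc n)"
    using suminf_mult[OF s, of y] by simp
  moreover have "suminf (\<lambda>n. y ^ n) * y = (\<Sum>n. y ^ Suc n)"
    using suminf_mult2[OF s, of y] by (simp add: power_commutes)
  ultimately show thesis
    using that[of "suminf (\<lambda>n. y ^ n)"] shift by (simp add: left_diff_distrib right_diff_distrib)
qed

text \<open>For \<open>t = norm p + e\<close>, the difference of \<open>t\<close> and
  \<open>P = p + e\<close> has norm at most \<open>norm p < t\<close>, so a Neumann series gives an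
  inverse \<open>N\<close> of \<open>P\<close>; then \<open>b = r * N\<close>.\<close>

lemma square_pos_inverse_sqrt:
  fixes p :: "'a::cstar_algebra_1"
  assumes p: "square_pos p" and e: "e > 0"
  obtains r b where "star r = r" "star b = b" "r * b = 1" "b * r = 1" "r * r = p + e *\<^sub>R 1"
proof -
  define P where "P = p + e *\<^sub>R 1"
  have "square_pos (1::'a)" using square_posI[of "1::'a"] by simp
  with p e have "square_pos P" by (simp add: P_def square_pos_add square_pos_scaleR)
  then obtain r where r: "star r = r" "r * r = P" by (auto simp: square_pos_def)
  define t where "t = norm p + e"
  have t: "t > 0" using e by (simp add: t_def add_nonneg_pos)
  have "norm (t *\<^sub>R 1 - P) \<le> norm p"
    using square_pos_norm_bound[OF p order_refl] by (simp add: t_def P_def algebra_simps)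
  moreover have "t *\<^sub>R 1 - P = t *\<^sub>R (1 - (1/t) *\<^sub>R P)" using t by (simp add: scaleR_diff_right)
  ultimately have "t * norm (1 - (1/t) *\<^sub>R P) \<le> norm p" using t by simp
  moreover have "norm p < t" using e by (simp add: t_def)
  ultimately have "t * norm (1 - (1/t) *\<^sub>R P) < t * 1" by simp
  then have "norm (1 - (1/t) *\<^sub>R P) < 1" using t by simp
  then obtain z where z: "(1/t) *\<^sub>R P * z = 1" "z * (1/t) *\<^sub>R P = 1"
    by (rule inverse_one_minus_exists) simp
  define N where "N = (1/t) *\<^sub>R z"
  have N: "P * N = 1" "N * P = 1" using z by (simp_all add: N_def)
  have rP: "r * P = P * r" by (simp add: r(2)[symmetric] mult.assoc)
  have "N * r = N * (r * P) * N" by (simp add: mult.assoc N)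
  also have "\<dots> = r * N" unfolding rP by (simp add: N flip: mult.assoc)
  finally have Nr: "N * r = r * N" .
  have rb: "r * (r * N) = 1" by (simp add: r N flip: mult.assoc)
  have br: "r * N * r = 1" by (simp add: mult.assoc Nr rb)
  \<comment> \<open>\<open>star (r * N)\<close> is a left and \<open>r * N\<close> a right inverse
    of \<open>r\<close>, so they coincide.\<close>
  have "star (r * N) * r = 1" using arg_cong[OF rb, of star] by (simp add: star_mult r)
  then have "star (r * N) = r * N" using rb by (metis mult.assoc mult.left_neutral mult.right_neutral)
  with r rb br that show thesis by (simp add: P_def)
qed

text \<open>
  With \<open>b = (p + \<epsilon>)\<^bsup>-1/2\<^esup>\<close> and \<open>d = b q b\<close>, testing with \<open>a = d b\<close> gives
  \<open>\<parallel>d\<parallel>\<^sup>3 \<le> C \<parallel>d\<parallel>\<^sup>2\<close>. This choice of \<open>a\<close>, rather than \<open>a = b\<close>, lies in every ideal that contains \<open>q\<close>.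
\<close>

lemma square_pos_diff_if_norm_le:
  fixes p q :: "'a::cstar_algebra_1"
  assumes p: "square_pos p" and q: "square_pos q" and C: "C \<ge> 0"
    and le: "\<And>x y. norm (x * q * y * q * star (x * q * y)) \<le> C * norm (x * q * y * p * star (x * q * y))"
  shows "square_pos (C *\<^sub>R p - q)"
proof -
  \<comment> \<open>Adding \<open>e\<close> makes \<open>p\<close> invertible; closedness of the
    cone lets \<open>e\<close> tend to 0 at the end.\<close>
  have eps: "square_pos (C *\<^sub>R (p + e *\<^sub>R 1) - q)" if e: "e > 0" for e
  proof -
    obtain r b where rb: "star r = r" "star b = b" "r * b = 1" "b * r = 1" "r * r = p + e *\<^sub>R 1"
      by (rule square_pos_inverse_sqrt[OF p e]) blast
    define d where "d = b * q * b"
    have conj: "square_pos (b * h * b)" if "square_pos h" for h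
    proof -
      obtain w where "star w = w" "h = w * w" using \<open>square_pos h\<close> by (auto simp: square_pos_def)
      then show ?thesis using square_pos_star_mult[of "w * b"] rb by (simp add: star_mult mult.assoc)
    qed
    have d: "square_pos d" using conj[OF q] by (simp add: d_def)
    have sd: "star d = d" by (rule square_pos_hermitian[OF d])
    have "r * r - e *\<^sub>R 1 = p" by (simp add: rb)
    then have "b * p * b = b * (r * r - e *\<^sub>R 1) * b" by simp
    also have "\<dots> = (b * r) * (r * b) - e *\<^sub>R (b * b)" by (simp add: algebra_simps)
    finally have "1 - b * p * b = e *\<^sub>R (b * b)" by (simp add: rb)
    then have "square_pos (1 - b * p * b)"
      using e square_posI[OF rb(2)] by (simp add: square_pos_scaleR)
    then have np: "norm (b * p * b) \<le> 1"
      using square_pos_norm_mono[OF conj[OF p], of 1] by simp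
    \<comment> \<open>The hypothesis is used at \<open>x = b\<close> and \<open>y = b * b\<close>,
      where \<open>x * q * y = d * b\<close>.\<close>
    have "norm (d * d * d) = norm (b * q * (b * b) * q * star (b * q * (b * b)))"
      using arg_cong[OF sd, of "\<lambda>z. d * b * q * (b * z)"] sd
      by (simp add: d_def star_mult rb square_pos_hermitian[OF q] mult.assoc)
    also have "\<dots> \<le> C * norm (b * q * (b * b) * p * star (b * q * (b * b)))" by (rule le)
    also have "b * q * (b * b) * p * star (b * q * (b * b)) = d * (b * p * b) * d"
      by (simp add: d_def star_mult rb square_pos_hermitian[OF q] mult.assoc)
    also have "norm (d * (b * p * b) * d) \<le> norm d * norm (b * p * b) * norm d"
      using order_trans[OF norm_mult_ineq mult_right_mono[OF norm_mult_ineq norm_ge_zero]] .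
    also have "\<dots> \<le> norm d * norm d"
      using np by (simp add: mult_left_le mult_right_mono)
    finally have cub: "norm (d * d * d) \<le> C * (norm d * norm d)" using C by (simp add: mult_left_mono)
    have "norm d \<le> C"
    proof (cases "d = 0")
      case False
      \<comment> \<open>For self-adjoint \<open>d\<close> the fourth power of the norm is the norm
        of the fourth power, so the cubic bound yields \<open>norm d \<le> C\<close> after
        cancellation.\<close>
      have "((norm d)\<^sup>2)\<^sup>2 = norm ((d * d) * (d * d))"
        by (simp add: cstar_identity_hermitian star_mult sd)
      also have "\<dots> \<le> norm (d * d * d) * norm d" by (metis mult.assoc norm_mult_ineq)
      also have "\<dots> \<le> C * (norm d * norm d) * norm d" using cub by (simp add: mult_right_mono)
      finally have "norm d * norm d ^ 3 \<le> C * norm d ^ 3"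
        by (simp add: power2_eq_square power3_eq_cube mult.assoc)
      then show ?thesis using False by simp
    qed (use C in simp)
    then have "square_pos (C *\<^sub>R 1 - d)" by (rule square_pos_norm_diff[OF d])
    then obtain w where w: "star w = w" "C *\<^sub>R 1 - d = w * w" by (auto simp: square_pos_def)
    \<comment> \<open>Conjugation by \<open>r\<close>, the inverse of \<open>b\<close>, turns
      \<open>C - d\<close> back into \<open>C (p + e) - q\<close>.\<close>
    have "r * d * r = (r * b) * q * (b * r)" by (simp add: d_def mult.assoc)
    then have "C *\<^sub>R (p + e *\<^sub>R 1) - q = r * (C *\<^sub>R 1 - d) * r"
      by (simp add: algebra_simps rb)
    also have "\<dots> = star (w * r) * (w * r)" by (simp add: w rb star_mult mult.assoc)
    finally show ?thesis by (simp add: square_pos_star_mult)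
  qed
  have lim: "(\<lambda>n. C *\<^sub>R (p + inverse (real (Suc n)) *\<^sub>R 1) - q) \<longlonglongrightarrow> C *\<^sub>R (p + 0 *\<^sub>R 1) - q"
    by (intro tendsto_intros LIMSEQ_inverse_real_of_nat)
  have mem: "C *\<^sub>R (p + inverse (real (Suc n)) *\<^sub>R 1) - q \<in> {h. square_pos h}" for n
    using eps[of "inverse (real (Suc n))"] by simp
  show ?thesis using closed_sequentially[OF closed_square_pos mem lim] by simp
qed

section \<open>The unitization\<close>

text \<open>\<open>Unitization a l\<close> stands for the formal sum \<open>a + l 1\<close>.\<close>

datatype 'a unitization = Unitization (base: 'a) (scal: complex)

instantiation unitization :: (cstar_algebra) real_vector
begin

definition "0 = Unitization 0 0"
definition "x + y = Unitization (base x + base y) (scal x + scal y)"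
definition "x - y = Unitization (base x - base y) (scal x - scal y)"
definition "- x = Unitization (- base x) (- scal x)"
definition "r *\<^sub>R x = Unitization (r *\<^sub>R base x) (r *\<^sub>R scal x)"

lemma base_scal_linear [simp]:
  "base 0 = (0::'a)" "scal (0::'a unitization) = 0"
  "base (x + y) = base x + base (y::'a unitization)" "scal (x + y) = scal x + scal y"
  "base (x - y) = base x - base y" "scal (x - y) = scal x - scal y"
  "base (- x) = - base x" "scal (- x) = - scal x"
  "base (r *\<^sub>R x) = r *\<^sub>R base x" "scal (r *\<^sub>R x) = r *\<^sub>R scal x"
  by (simp_all add: zero_unitization_def plus_unitization_def minus_unitization_def
      uminus_unitization_def scaleR_unitization_def)

instance
  by standard (simp_all add: unitization.expand scaleR_add_right scaleR_add_left
      scaleR_right.add algebra_simps)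

end

instantiation unitization :: (cstar_algebra) complex_vector
begin

definition "c *\<^sub>C x = Unitization (c *\<^sub>C base x) (c * scal x)"

lemma base_scal_scaleC [simp]:
  "base (c *\<^sub>C x) = c *\<^sub>C base x" "scal (c *\<^sub>C x) = c * scal x"
  by (simp_all add: scaleC_unitization_def)

instance
  by standard (simp_all add: unitization.expand scaleC_add_right scaleC_add_left scaleC_scaleC
      scaleR_eq_scaleC algebra_simps scaleR_conv_of_real)

end

text \<open>Left multiplication on the ideal \<open>'a\<close>; its operator norm is the source of
  the C*-norm.\<close>

definition lmult :: "'a::cstar_algebra unitization \<Rightarrow> 'a \<Rightarrow> 'a"
  where "lmult x z = base x * z + scal x *\<^sub>C z"

lemma bounded_linear_scaleC: "bounded_linear (\<lambda>z. c *\<^sub>C (z::'a::complex_normed_vector))"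
  by (rule bounded_linear_intro[where K = "cmod c"])
     (auto simp: scaleC_add_right scaleR_scaleC norm_scaleC mult.commute)

lemma bounded_linear_lmult: "bounded_linear (lmult x)"
  unfolding lmult_def [abs_def]
  by (intro bounded_linear_add bounded_linear_mult_right bounded_linear_scaleC)

text \<open>
  The scalar part enters the norm explicitly, so that this is a norm also when \<open>'a\<close>
  already has a unit.
\<close>

instantiation unitization :: (cstar_algebra) real_normed_vector
begin

definition norm_unitization_def: "norm x = max (onorm (lmult x)) (cmod (scal x))"
definition "dist x y = norm (x - y :: 'a unitization)"
definition "sgn x = x /\<^sub>R norm (x :: 'a unitization)"
definition [code del]: "(uniformity :: ('a unitization \<times> 'a unitization) filter)
  = (INF e\<in>{0<..}. principal {(x, y). dist x y < e})"
definition [code del]: "open (U :: 'a unitization set) \<longleftrightarrow>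
  (\<forall>x\<in>U. \<forall>\<^sub>F (x', y) in uniformity. x' = x \<longrightarrow> y \<in> U)"

lemma norm_scal_le: "cmod (scal x) \<le> norm (x :: 'a unitization)"
  by (simp add: norm_unitization_def)

lemma norm_lmult_le: "norm (lmult x z) \<le> norm x * norm (z :: 'a)"
  using onorm[OF bounded_linear_lmult, of x z]
  by (rule order_trans) (simp add: norm_unitization_def mult_right_mono)

lemma norm_unitization_le:
  fixes x :: "'a unitization"
  assumes "\<And>z. norm (lmult x z) \<le> b * norm z" and "cmod (scal x) \<le> b"
  shows "norm x \<le> b"
  unfolding norm_unitization_def using assms order_trans[OF norm_ge_zero assms(2)]
  by (auto intro: onorm_bound)

text \<open>Evaluating the action at \<open>star (base x)\<close> isolates
  \<open>base x * star (base x)\<close>, of norm \<open>norm (base x)\<close> squared. This makes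
  the norm definite and \<open>base\<close> continuous.\<close>

lemma norm_base_le: "norm (base x) \<le> 2 * norm (x :: 'a unitization)"
proof (cases "base x = 0")
  case False
  have "(norm (base x))\<^sup>2 = norm (lmult x (star (base x)) - scal x *\<^sub>C star (base x))"
    by (simp add: lmult_def cstar_identity')
  also have "\<dots> \<le> norm x * norm (base x) + norm x * norm (base x)"
    using norm_lmult_le[of x "star (base x)"] norm_scal_le[of x]
    by (intro order_trans[OF norm_triangle_ineq4] add_mono) (auto simp: norm_scaleC mult_right_mono)
  finally show ?thesis using False by (simp add: power2_eq_square)
qed (simp add: norm_unitization_def le_max_iff_disj)

lemma norm_unitization_le_sum: "norm (x :: 'a unitization) \<le> norm (base x) + cmod (scal x)"
proof (rule norm_unitization_le)
  fix z :: 'a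
  show "norm (lmult x z) \<le> (norm (base x) + cmod (scal x)) * norm z"
    unfolding lmult_def distrib_right
    by (intro order_trans[OF norm_triangle_ineq] add_mono norm_mult_ineq) (simp add: norm_scaleC)
qed simp

instance
proof
  fix x y :: "'a unitization" and r :: real
  show "norm x = 0 \<longleftrightarrow> x = 0"
    using norm_scal_le[of x] norm_base_le[of x] norm_unitization_le_sum[of x]
    by (auto simp: unitization.expand norm_le_zero_iff)
  have "lmult (x + y) z = lmult x z + lmult y z" for z
    by (simp add: lmult_def distrib_right scaleC_add_left add_ac)
  then show "norm (x + y) \<le> norm x + norm y"
    using norm_lmult_le[of x] norm_lmult_le[of y] norm_scal_le[of x] norm_scal_le[of y]
    by (intro norm_unitization_le)
       (auto simp: distrib_right intro!: order_trans[OF norm_triangle_ineq] add_mono)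
  have "lmult (r *\<^sub>R x) = (\<lambda>z. r *\<^sub>R lmult x z)"
    by (simp add: lmult_def fun_eq_iff scaleC_add_right scaleR_eq_scaleC scaleC_scaleC
        scaleR_conv_of_real mult_scaleC_left)
  then show "norm (r *\<^sub>R x) = \<bar>r\<bar> * norm x"
    by (simp add: norm_unitization_def onorm_scaleR[OF bounded_linear_lmult] max_mult_distrib_left)
qed (rule dist_unitization_def sgn_unitization_def uniformity_unitization_def open_unitization_def)+

end

lemma bounded_linear_base: "bounded_linear base"
  by (rule bounded_linear_intro[where K = 2]) (use norm_base_le in \<open>auto simp: mult.commute\<close>)

lemma bounded_linear_scal: "bounded_linear scal"
  by (rule bounded_linear_intro[where K = 1]) (use norm_scal_le in auto)

instantiation unitization :: (cstar_algebra) cstar_algebra_1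
begin

definition "1 = Unitization (0::'a) 1"
definition "x * y = Unitization (base x * base y + scal x *\<^sub>C base y + scal y *\<^sub>C base x)
   (scal x * scal y)"
definition "star x = Unitization (star (base x)) (cnj (scal x))"

lemma base_scal_algebra [simp]:
  "base 1 = (0::'a)" "scal (1::'a unitization) = 1"
  "base (x * y) = base x * base y + scal x *\<^sub>C base y + scal y *\<^sub>C base x"
  "scal (x * y) = scal x * scal y"
  "base (star x) = star (base x)" "scal (star x) = cnj (scal x)"
  by (simp_all add: one_unitization_def times_unitization_def star_unitization_def)

lemma lmult_mult: "lmult (x * y) z = lmult x (lmult y z)"
  by (simp add: lmult_def algebra_simps scaleC_add_right scaleC_add_left scaleC_scaleC
      mult_scaleC_left mult_scaleC_right)

text \<open>The adjoint relation for the action, with \<open>star z * w\<close> as inner product on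
  the ideal; the C*-identity rests on it.\<close>

lemma lmult_star: "star (lmult x z) * w = star z * lmult (star x) w"
  by (simp add: lmult_def star_simps star_scaleC algebra_simps mult_scaleC_left mult_scaleC_right)

lemma norm_mult_unitization_le: "norm (x * y) \<le> norm x * norm (y :: 'a unitization)"
proof (rule norm_unitization_le)
  fix z :: 'a
  have "norm (lmult (x * y) z) \<le> norm x * norm (lmult y z)"
    by (simp add: lmult_mult norm_lmult_le)
  also have "\<dots> \<le> norm x * norm y * norm z"
    by (simp add: mult.assoc mult_left_mono norm_lmult_le)
  finally show "norm (lmult (x * y) z) \<le> norm x * norm y * norm z" .
qed (simp add: norm_mult mult_mono norm_scal_le)

lemma norm_power2_unitization_le: "(norm x)\<^sup>2 \<le> norm (star x * x :: 'a unitization)"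
proof -
  have "norm x \<le> sqrt (norm (star x * x))"
  proof (rule norm_unitization_le)
    fix z :: 'a
    have "(norm (lmult x z))\<^sup>2 = norm (star z * lmult (star x * x) z)"
      by (simp add: lmult_star lmult_mult flip: cstar_identity)
    also have "\<dots> \<le> norm z * (norm (star x * x) * norm z)"
      by (intro order_trans[OF norm_mult_ineq] mult_mono norm_lmult_le) auto
    also have "\<dots> = (sqrt (norm (star x * x)) * norm z)\<^sup>2"
      by (simp add: power_mult_distrib power2_eq_square)
    finally show "norm (lmult x z) \<le> sqrt (norm (star x * x)) * norm z"
      by (rule power2_le_imp_le) simp
    have "(cmod (scal x))\<^sup>2 \<le> norm (star x * x)"
      using norm_scal_le[of "star x * x"] by (simp add: norm_mult power2_eq_square)
    then show "cmod (scal x) \<le> sqrt (norm (star x * x))" by (rule real_le_rsqrt)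
  qed
  then have "(norm x)\<^sup>2 \<le> (sqrt (norm (star x * x)))\<^sup>2" by (rule power_mono) simp
  then show ?thesis by simp
qed

instance
proof
  fix x y z :: "'a unitization" and c :: complex and r :: real
  show "norm (c *\<^sub>C x) = cmod c * norm x"
  proof -
    have le: "norm (c *\<^sub>C x) \<le> cmod c * norm x" for c and x :: "'a unitization"
    proof (rule norm_unitization_le)
      fix z :: 'a
      have "lmult (c *\<^sub>C x) z = c *\<^sub>C lmult x z"
        by (simp add: lmult_def scaleC_add_right scaleC_scaleC mult_scaleC_left)
      then show "norm (lmult (c *\<^sub>C x) z) \<le> cmod c * norm x * norm z"
        by (simp add: norm_scaleC mult.assoc mult_left_mono norm_lmult_le)
    qed (simp add: norm_mult mult_left_mono norm_scal_le)
    have "cmod c * norm x \<le> norm (c *\<^sub>C x)" if "c \<noteq> 0"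
    proof -
      have "norm x = norm (inverse c *\<^sub>C (c *\<^sub>C x))" using that by (simp add: scaleC_scaleC)
      also have "\<dots> \<le> inverse (cmod c) * norm (c *\<^sub>C x)" using le by (metis norm_inverse)
      finally show ?thesis using that by (simp add: field_simps)
    qed
    with le[of c x] show ?thesis by (cases "c = 0") auto
  qed
  show "norm (x * y) \<le> norm x * norm y" by (rule norm_mult_unitization_le)
  show "norm (star x * x) = (norm x)\<^sup>2"
  proof -
    \<comment> \<open>The half of the C*-identity already proved makes \<open>star\<close>
      isometric, and this gives the other half.\<close>
    have "norm x \<le> norm (star x)" for x :: "'a unitization"
    proof (cases "x = 0")
      case False
      have "(norm x)\<^sup>2 \<le> norm (star x) * norm x"
        using norm_power2_unitization_le norm_mult_unitization_le order_trans by blast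
      with False show ?thesis by (simp add: power2_eq_square)
    qed simp
    moreover have "star (star x) = x" by (simp add: unitization.expand star_star)
    ultimately have "norm (star x) = norm x" by (metis antisym)
    then show ?thesis
      using norm_power2_unitization_le[of x] norm_mult_unitization_le[of "star x" x]
      by (simp add: power2_eq_square)
  qed
  have "scal (0 :: 'a unitization) \<noteq> scal 1" by simp
  then show "(0 :: 'a unitization) \<noteq> 1" by metis
  show "norm (1 :: 'a unitization) = 1"
    using norm_scal_le[of "1 :: 'a unitization"] norm_unitization_le_sum[of "1 :: 'a unitization"]
    by simp
next
  fix X :: "nat \<Rightarrow> 'a unitization"
  assume X: "Cauchy X"
  \<comment> \<open>Completeness is componentwise: both projections are bounded, and the norm is at
    most the sum of the component norms.\<close>
  have "Cauchy (\<lambda>n. base (X n))" "Cauchy (\<lambda>n. scal (X n))"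
    by (rule bounded_linear.Cauchy[OF bounded_linear_base X]
        bounded_linear.Cauchy[OF bounded_linear_scal X])+
  then obtain a l where al: "(\<lambda>n. base (X n)) \<longlonglongrightarrow> a" "(\<lambda>n. scal (X n)) \<longlonglongrightarrow> l"
    by (meson Cauchy_convergent convergent_def)
  have "(\<lambda>n. norm (X n - Unitization a l)) \<longlonglongrightarrow> 0"
  proof (rule tendsto_sandwich[OF _ _ tendsto_const])
    have "(\<lambda>n. norm (base (X n) - a) + cmod (scal (X n) - l)) \<longlonglongrightarrow> norm (a - a) + cmod (l - l)"
      by (intro tendsto_intros al)
    then show "(\<lambda>n. norm (base (X n) - a) + cmod (scal (X n) - l)) \<longlonglongrightarrow> 0" by simp
    show "\<forall>\<^sub>F n in sequentially. norm (X n - Unitization a l)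
        \<le> norm (base (X n) - a) + cmod (scal (X n) - l)"
      using norm_unitization_le_sum[of "X n - Unitization a l" for n] by simp
  qed simp
  then have "X \<longlonglongrightarrow> Unitization a l" by (simp add: tendsto_norm_zero_iff LIM_zero_iff)
  then show "convergent X" by (auto simp: convergent_def)
qed (auto simp: unitization.expand algebra_simps scaleC_add_right scaleC_add_left scaleC_scaleC
    mult_scaleC_left mult_scaleC_right star_simps star_scaleC scaleR_eq_scaleC scaleR_conv_of_real)

end

definition unitize :: "'a::cstar_algebra \<Rightarrow> 'a unitization"
  where "unitize a = Unitization a 0"

lemma base_unitize [simp]: "base (unitize a) = a" "scal (unitize a) = 0"
  by (simp_all add: unitize_def)

lemma unitize_simps:
  "unitize (a + b) = unitize a + unitize b" "unitize (a - b) = unitize a - unitize b"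
  "unitize (a * b) = unitize a * unitize b" "unitize (star a) = star (unitize a)"
  "unitize (r *\<^sub>R a) = r *\<^sub>R unitize a" "unitize 0 = 0"
  by (simp_all add: unitization.expand)

lemma norm_unitize: "norm (unitize a) = norm a"
proof (rule antisym)
  show "norm (unitize a) \<le> norm a" using norm_unitization_le_sum[of "unitize a"] by simp
  show "norm a \<le> norm (unitize a)"
  proof (cases "a = 0")
    case False
    have "norm a * norm a = norm (lmult (unitize a) (star a))"
      by (simp add: lmult_def cstar_identity' flip: power2_eq_square)
    also have "\<dots> \<le> norm (unitize a) * norm a" using norm_lmult_le[of "unitize a" "star a"] by simp
    finally show ?thesis using False by simp
  qed simp
qed

lemma bounded_linear_unitize: "bounded_linear unitize"
  by (rule bounded_linear_intro[where K = 1]) (auto simp: unitize_simps norm_unitize)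

section \<open>The positive cone\<close>

lemma cstar_nonneg_iff: "0 \<preceq> a \<longleftrightarrow> square_pos (unitize a)"
proof
  assume "0 \<preceq> a"
  then obtain c where "a = star c * c" by (auto simp: cstar_le_def)
  then show "square_pos (unitize a)" by (simp add: unitize_simps square_pos_star_mult)
next
  assume "square_pos (unitize a)"
  then obtain s where s: "star s = s" "unitize a = s * s" by (auto simp: square_pos_def)
  \<comment> \<open>The scalar part squares to 0, so the root already lies in
    \<open>'a\<close>.\<close>
  have "scal s = 0" using arg_cong[OF s(2), of scal] by simp
  moreover have "star (base s) = base s" using arg_cong[OF s(1), of base] by simp
  ultimately show "0 \<preceq> a"
    using arg_cong[OF s(2), of base] by (auto simp: cstar_le_def intro!: exI[of _ "base s"])
qed

lemma cstar_le_iff: "a \<preceq> b \<longleftrightarrow> 0 \<preceq> b - a"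
  by (simp add: cstar_le_def)

lemma cstar_nonneg_add: "0 \<preceq> a \<Longrightarrow> 0 \<preceq> b \<Longrightarrow> 0 \<preceq> a + b"
  by (simp add: cstar_nonneg_iff unitize_simps square_pos_add)

lemma cstar_nonneg_scaleR: "0 \<preceq> a \<Longrightarrow> r \<ge> 0 \<Longrightarrow> 0 \<preceq> r *\<^sub>R a"
  by (simp add: cstar_nonneg_iff unitize_simps square_pos_scaleR)

lemma closed_cstar_nonneg: "closed {a. 0 \<preceq> a}"
  using continuous_closed_vimage[OF closed_square_pos linear_continuous_at[OF bounded_linear_unitize]]
  by (simp add: cstar_nonneg_iff vimage_def)

lemma cstar_norm_mono: "0 \<preceq> a \<Longrightarrow> a \<preceq> b \<Longrightarrow> norm a \<le> norm b"
  using square_pos_norm_mono[of "unitize a" "unitize b"]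
  by (simp add: cstar_le_iff[of a b] cstar_nonneg_iff unitize_simps norm_unitize)

text \<open>\<open>x * unitize q * y\<close> stays in the ideal \<open>'a\<close>, so tests by
  elements of \<open>'a\<close> alone supply the hypothesis of
  \<open>square_pos_diff_if_norm_le\<close>.\<close>

lemma cstar_le_if_norm_le:
  assumes p: "0 \<preceq> p" and q: "0 \<preceq> q" and C: "C \<ge> 0"
    and le: "\<And>a. norm (a * q * star a) \<le> C * norm (a * p * star a)"
  shows "q \<preceq> C *\<^sub>R p"
proof -
  have "square_pos (C *\<^sub>R unitize p - unitize q)"
  proof (rule square_pos_diff_if_norm_le)
    fix x y :: "'a unitization"
    define a where "a = base (x * unitize q * y)"
    have "x * unitize q * y = unitize a" by (simp add: unitization.expand a_def)
    then show "norm (x * unitize q * y * unitize q * star (x * unitize q * y))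
        \<le> C * norm (x * unitize q * y * unitize p * star (x * unitize q * y))"
      using le[of a] by (simp add: norm_unitize flip: unitize_simps)
  qed (use p q C in \<open>simp_all add: cstar_nonneg_iff\<close>)
  then show ?thesis by (simp add: cstar_le_iff[of q] cstar_nonneg_iff unitize_simps)
qed

section \<open>Separation of points from closed convex cones\<close>

definition sublinear :: "('a::real_vector \<Rightarrow> real) \<Rightarrow> bool"
  where "sublinear p \<longleftrightarrow> (\<forall>x y. p (x + y) \<le> p x + p y) \<and> (\<forall>r>0. \<forall>x. p (r *\<^sub>R x) = r * p x)"

lemma sublinearI:
  fixes p :: "'a::real_vector \<Rightarrow> real"
  assumes "\<And>x y. p (x + y) \<le> p x + p y" and le: "\<And>r x. r > 0 \<Longrightarrow> p (r *\<^sub>R x) \<le> r * p x"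
  shows "sublinear p"
  unfolding sublinear_def
proof (intro conjI allI impI)
  fix r :: real and x assume r: "r > 0"
  have "r * p x = r * p (inverse r *\<^sub>R (r *\<^sub>R x))" using r by simp
  also have "\<dots> \<le> r * (inverse r * p (r *\<^sub>R x))" using r by (intro mult_left_mono le) auto
  also have "\<dots> = p (r *\<^sub>R x)" using r by simp
  finally show "p (r *\<^sub>R x) = r * p x" using le[OF r, of x] by simp
qed (rule assms)

lemma sublinear_zero: "sublinear p \<Longrightarrow> p 0 = 0"
proof -
  assume "sublinear p"
  then have "p ((2::real) *\<^sub>R 0) = 2 * p 0" unfolding sublinear_def by (metis zero_less_numeral)
  then show ?thesis by simp
qed

lemma sublinear_scaleR: "sublinear p \<Longrightarrow> r \<ge> 0 \<Longrightarrow> p (r *\<^sub>R x) = r * p x"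
  by (cases "r = 0") (auto simp: sublinear_zero, auto simp: sublinear_def)

lemma sublinear_neg_le:
  assumes p: "sublinear p"
  shows "- p (- x) \<le> p x"
proof -
  have "p (x + - x) \<le> p x + p (- x)" using p unfolding sublinear_def by blast
  then show ?thesis by (simp add: sublinear_zero[OF p])
qed

text \<open>Subadditivity compares two members, one at \<open>x\<close> and one at \<open>y\<close>;
  directedness replaces them by a common lower one.\<close>

lemma sublinear_Inf:
  assumes S: "S \<noteq> {}" "\<And>q. q \<in> S \<Longrightarrow> sublinear q"
    and bdd: "\<And>x. bdd_below ((\<lambda>q. q x) ` S)"
    and dir: "\<And>q q'. q \<in> S \<Longrightarrow> q' \<in> S \<Longrightarrow> \<exists>u\<in>S. u \<le> q \<and> u \<le> q'"
  shows "sublinear (\<lambda>x. INF q\<in>S. q x)"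
proof (rule sublinearI)
  fix x y
  have "(INF q\<in>S. q (x + y)) - q' y \<le> q x" if q: "q \<in> S" "q' \<in> S" for q q'
  proof -
    obtain u where u: "u \<in> S" "u x \<le> q x" "u y \<le> q' y" using dir[OF q] by (auto simp: le_fun_def)
    have "(INF q\<in>S. q (x + y)) \<le> u (x + y)" by (rule cINF_lower[OF bdd u(1)])
    also have "\<dots> \<le> u x + u y" using S(2)[OF u(1)] by (simp add: sublinear_def)
    finally show ?thesis using u by simp
  qed
  then have "(INF q\<in>S. q (x + y)) - q' y \<le> (INF q\<in>S. q x)" if "q' \<in> S" for q'
    using that by (intro cINF_greatest[OF S(1)])
  then have "(INF q\<in>S. q (x + y)) - (INF q\<in>S. q x) \<le> q' y" if "q' \<in> S" for q'
    using that by (simp add: algebra_simps)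
  then have "(INF q\<in>S. q (x + y)) - (INF q\<in>S. q x) \<le> (INF q\<in>S. q y)"
    by (intro cINF_greatest[OF S(1)])
  then show "(INF q\<in>S. q (x + y)) \<le> (INF q\<in>S. q x) + (INF q\<in>S. q y)" by simp
next
  fix r :: real and x assume r: "r > 0"
  have "(INF q\<in>S. q (r *\<^sub>R x)) / r \<le> q x" if q: "q \<in> S" for q
    using cINF_lower[OF bdd q, of "r *\<^sub>R x"] S(2)[OF q] r
    by (simp add: sublinear_def pos_divide_le_eq mult.commute)
  then have "(INF q\<in>S. q (r *\<^sub>R x)) / r \<le> (INF q\<in>S. q x)"
    by (intro cINF_greatest[OF S(1)])
  then show "(INF q\<in>S. q (r *\<^sub>R x)) \<le> r * (INF q\<in>S. q x)"
    using r by (simp add: pos_divide_le_eq mult.commute)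
qed

text \<open>\<open>q z\<close> is the infimum of \<open>p (z + t y) - t p y\<close> over
  \<open>t \<ge> 0\<close>, finite because \<open>- p (- z)\<close> is a lower bound. At
  \<open>z = - y\<close> the last bound reads \<open>q (- y) \<le> - p y\<close>, which forces
  linear minorants of \<open>q\<close> up to \<open>p y\<close> at \<open>y\<close>.\<close>

lemma sublinear_minorant_odd_at:
  fixes p :: "'a::real_vector \<Rightarrow> real"
  assumes p: "sublinear p"
  obtains q where "sublinear q" "q \<le> p" "\<And>z. q z \<le> p (z + y) - p y"
proof -
  define Q where "Q t = (\<lambda>z. p (z + t *\<^sub>R y) - t * p y)" for t :: real
  define q where "q z = (INF t\<in>{0..}. Q t z)" for z
  have sub: "p (a + b) \<le> p a + p b" for a b using p by (simp add: sublinear_def)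
  have lower: "- p (- z) \<le> Q t z" if "t \<ge> 0" for t z
    using sub[of "z + t *\<^sub>R y" "- z"] sublinear_scaleR[OF p that, of y] by (simp add: Q_def)
  have bdd: "bdd_below ((\<lambda>t. Q t z) ` {0..})" for z
    by (rule bdd_belowI2[of _ "- p (- z)"]) (simp add: lower)
  have le: "q z \<le> Q t z" if "t \<ge> 0" for t z
    unfolding q_def using that by (intro cINF_lower[OF bdd]) simp
  have greatest: "a \<le> q z" if "\<And>t. t \<ge> 0 \<Longrightarrow> a \<le> Q t z" for a z
    unfolding q_def using that by (intro cINF_greatest) auto
  have "sublinear q"
  proof (rule sublinearI)
    fix a b
    have "q (a + b) \<le> Q s a + Q t b" if "s \<ge> 0" "t \<ge> 0" for s t
    proof -
      have "q (a + b) \<le> Q (s + t) (a + b)" using that by (intro le) simp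
      also have "\<dots> \<le> Q s a + Q t b"
        using sub[of "a + s *\<^sub>R y" "b + t *\<^sub>R y"] by (simp add: Q_def algebra_simps)
      finally show ?thesis .
    qed
    then have "q (a + b) - Q t b \<le> q a" if "t \<ge> 0" for t
      using that by (intro greatest) (simp add: algebra_simps)
    then have "q (a + b) - q a \<le> q b" by (intro greatest) (simp add: algebra_simps)
    then show "q (a + b) \<le> q a + q b" by simp
  next
    fix r :: real and z assume r: "r > 0"
    have "Q (r * t) (r *\<^sub>R z) = r * Q t z" for t
      using sublinear_scaleR[OF p, of r "z + t *\<^sub>R y"] r
      by (simp add: Q_def scaleR_add_right right_diff_distrib mult.assoc)
    then have "q (r *\<^sub>R z) \<le> r * Q t z" if "t \<ge> 0" for t
      using le[of "r * t" "r *\<^sub>R z"] that r by simp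
    then have "q (r *\<^sub>R z) / r \<le> q z"
      using r by (intro greatest) (simp add: pos_divide_le_eq mult.commute)
    then show "q (r *\<^sub>R z) \<le> r * q z" using r by (simp add: pos_divide_le_eq mult.commute)
  qed
  moreover have "q z \<le> p z" for z using le[of 0 z] by (simp add: Q_def)
  moreover have "q z \<le> p (z + y) - p y" for z using le[of 1 z] by (simp add: Q_def)
  ultimately show thesis using that by (auto simp: le_fun_def)
qed

text \<open>Zorn's lemma for the reversed pointwise order; infima of chains are finite because
  \<open>q \<le> p\<close> implies \<open>q x \<ge> - p (- x)\<close>.\<close>

lemma minimal_sublinear_exists:
  fixes p :: "'a::real_vector \<Rightarrow> real"
  assumes p: "sublinear p"
  obtains f where "sublinear f" "f \<le> p" "\<And>q. sublinear q \<Longrightarrow> q \<le> f \<Longrightarrow> q = f"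
proof -
  define A where "A = {q. sublinear q \<and> q \<le> p}"
  have "\<exists>m\<in>A. \<forall>a\<in>A. a \<le> m \<longrightarrow> a = m"
  proof (rule predicate_Zorn[of A "\<lambda>q r. r \<le> q"])
    show "partial_order_on A (relation_of (\<lambda>q r. r \<le> q) A)"
      by (rule partial_order_on_relation_ofI) auto
    fix C assume "C \<in> Chains (relation_of (\<lambda>q r. r \<le> q) A)"
    then have C: "C \<subseteq> A" "\<And>q r. q \<in> C \<Longrightarrow> r \<in> C \<Longrightarrow> r \<le> q \<or> q \<le> r"
      by (auto simp: Chains_def relation_of_def)
    show "\<exists>u\<in>A. \<forall>a\<in>C. u \<le> a"
    proof (cases "C = {}")
      case True
      then show ?thesis using p by (auto simp: A_def)
    next
      case False
      have bdd: "bdd_below ((\<lambda>q. q x) ` C)" for x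
      proof (rule bdd_belowI2)
        fix q assume "q \<in> C"
        then have "sublinear q" "q (- x) \<le> p (- x)" using C(1) by (auto simp: A_def le_fun_def)
        then show "- p (- x) \<le> q x" using sublinear_neg_le[of q x] by simp
      qed
      define u where "u x = (INF q\<in>C. q x)" for x
      have "sublinear u"
        unfolding u_def [abs_def]
      proof (rule sublinear_Inf[OF False _ bdd])
        show "\<exists>u\<in>C. u \<le> q \<and> u \<le> q'" if "q \<in> C" "q' \<in> C" for q q'
          using C(2)[OF that] that by auto
      qed (use C(1) in \<open>auto simp: A_def\<close>)
      moreover have u: "u \<le> q" if "q \<in> C" for q
        unfolding u_def le_fun_def using cINF_lower[OF bdd that] by simp
      moreover obtain q where "q \<in> C" using False by blast
      ultimately show ?thesis using C(1) by (auto simp: A_def intro!: bexI[of _ u] intro: order_trans)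
    qed
  qed
  then obtain f where f: "f \<in> A" "\<And>q. q \<in> A \<Longrightarrow> q \<le> f \<Longrightarrow> q = f" by blast
  show thesis
  proof (rule that[of f])
    show "q = f" if "sublinear q" "q \<le> f" for q
      using that f order_trans[OF that(2)] by (simp add: A_def)
  qed (use f(1) in \<open>auto simp: A_def\<close>)
qed

text \<open>Minimality identifies \<open>f\<close> with its minorant from
  \<open>sublinear_minorant_odd_at\<close>, whose bound reverses subadditivity.\<close>

lemma linear_if_minimal_sublinear:
  fixes f :: "'a::real_vector \<Rightarrow> real"
  assumes f: "sublinear f" and min: "\<And>q. sublinear q \<Longrightarrow> q \<le> f \<Longrightarrow> q = f"
  shows "linear f"
proof (rule linearI)
  fix x y :: 'a and r :: real
  show add: "f (x + y) = f x + f y" for x y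
  proof -
    obtain q where "sublinear q" "q \<le> f" "\<And>z. q z \<le> f (z + y) - f y"
      by (rule sublinear_minorant_odd_at[OF f]) blast
    then have "f x \<le> f (x + y) - f y" using min by metis
    moreover have "f (x + y) \<le> f x + f y" using f by (simp add: sublinear_def)
    ultimately show ?thesis by simp
  qed
  have neg: "f (- z) = - f z" for z
    using add[of z "- z"] sublinear_zero[OF f] by simp
  show "f (r *\<^sub>R x) = r *\<^sub>R f x"
    using sublinear_scaleR[OF f, of r x] sublinear_scaleR[OF f, of "- r" x] neg[of "r *\<^sub>R x"]
    by (cases "r \<ge> 0") auto
qed

text \<open>The minimal function is taken below the modified \<open>q\<close> rather than below
  \<open>p\<close>, which forces equality at \<open>x\<close>.\<close>

theorem Hahn_Banach_sublinear:
  fixes p :: "'a::real_vector \<Rightarrow> real"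
  assumes p: "sublinear p"
  obtains f where "linear f" "\<And>z. f z \<le> p z" "f x = p x"
proof -
  obtain q where q: "sublinear q" "q \<le> p" "\<And>z. q z \<le> p (z + x) - p x"
    by (rule sublinear_minorant_odd_at[OF p]) blast
  obtain f where f: "sublinear f" "f \<le> q" "\<And>u. sublinear u \<Longrightarrow> u \<le> f \<Longrightarrow> u = f"
    by (rule minimal_sublinear_exists[OF q(1)]) blast
  have lin: "linear f" by (rule linear_if_minimal_sublinear[OF f(1,3)])
  have le: "f z \<le> p z" for z using f(2) q(2) by (meson le_funD order_trans)
  have "f (- x) \<le> q (- x)" using f(2) by (rule le_funD)
  also have "\<dots> \<le> - p x" using q(3)[of "- x"] sublinear_zero[OF p] by simp
  finally have "p x \<le> f x" using linear_neg[OF lin, of x] by simp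
  with le[of x] lin le that show thesis by (metis antisym)
qed

text \<open>The distance to the cone is sublinear. Hahn-Banach gives a linear \<open>f\<close> below
  it and equal to it at \<open>x\<close>; \<open>- f\<close> separates. As \<open>0 \<in> C\<close>,
  the distance is at most the norm, so \<open>f\<close> is bounded.\<close>

theorem separating_functional_closed_cone:
  fixes C :: "'a::real_normed_vector set"
  assumes C: "closed C" "0 \<in> C" and add: "\<And>a b. a \<in> C \<Longrightarrow> b \<in> C \<Longrightarrow> a + b \<in> C"
    and scale: "\<And>r a. r > 0 \<Longrightarrow> a \<in> C \<Longrightarrow> r *\<^sub>R a \<in> C"
    and x: "x \<notin> C"
  obtains \<phi> :: "'a \<Rightarrow> real" where "bounded_linear \<phi>" "\<And>c. c \<in> C \<Longrightarrow> \<phi> c \<ge> 0" "\<phi> x < 0"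
proof -
  have ne: "C \<noteq> {}" using C by auto
  have greatest: "e \<le> infdist a C" if "\<And>c. c \<in> C \<Longrightarrow> e \<le> dist a c" for e a
    unfolding infdist_notempty[OF ne] by (rule cINF_greatest[OF ne that])
  have "sublinear (\<lambda>a. infdist a C)"
  proof (rule sublinearI)
    fix a b
    have "infdist (a + b) C \<le> dist a c + dist b c'" if "c \<in> C" "c' \<in> C" for c c'
      using infdist_le[OF add[OF that], of "a + b"] dist_triangle_add[of a b c c'] by simp
    then have "infdist (a + b) C - dist b c' \<le> infdist a C" if "c' \<in> C" for c'
      using that by (intro greatest) (simp add: algebra_simps)
    then have "infdist (a + b) C - infdist a C \<le> infdist b C"
      by (intro greatest) (simp add: algebra_simps)
    then show "infdist (a + b) C \<le> infdist a C + infdist b C" by simp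
  next
    fix r :: real and a assume r: "r > 0"
    have "infdist (r *\<^sub>R a) C \<le> r * dist a c" if "c \<in> C" for c
      using infdist_le[OF scale[OF r that], of "r *\<^sub>R a"] r
      by (simp add: dist_norm flip: scaleR_diff_right)
    then have "infdist (r *\<^sub>R a) C / r \<le> infdist a C"
      using r by (intro greatest) (simp add: pos_divide_le_eq mult.commute)
    then show "infdist (r *\<^sub>R a) C \<le> r * infdist a C"
      using r by (simp add: pos_divide_le_eq mult.commute)
  qed
  then obtain f where f: "linear f" "\<And>z. f z \<le> infdist z C" "f x = infdist x C"
    by (rule Hahn_Banach_sublinear[where x = x]) blast
  have le: "f z \<le> norm z" for z
    using f(2)[of z] infdist_le[OF C(2), of z] by simp
  have "\<bar>f z\<bar> \<le> norm z" for z
    using le[of z] le[of "- z"] linear_neg[OF f(1), of z] by (simp add: abs_le_iff)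
  then have "bounded_linear f"
    using f(1) by (intro bounded_linear_intro[where K = 1]) (auto simp: linear_add linear_scale)
  moreover have "f c \<le> 0" if "c \<in> C" for c using f(2)[of c] that by simp
  moreover have "f x > 0" using f(3) infdist_pos_not_in_closed[OF C(1) ne x] by simp
  ultimately show thesis
    using that[of "\<lambda>z. - f z"] by (auto intro: bounded_linear_minus)
qed


section \<open>Weak integrals\<close>

text \<open>A functional separating \<open>x\<close> from the cone would be negative at
  \<open>x\<close> yet have a nonnegative integral along \<open>F\<close>.\<close>

lemma has_weak_integral_in_closed_cone:
  fixes C :: "'b::real_normed_vector set"
  assumes "closed C" "0 \<in> C" "\<And>a b. a \<in> C \<Longrightarrow> b \<in> C \<Longrightarrow> a + b \<in> C"
    and "\<And>r a. r > 0 \<Longrightarrow> a \<in> C \<Longrightarrow> r *\<^sub>R a \<in> C"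
    and I: "has_weak_integral M F x" and F: "\<And>m. m \<in> space M \<Longrightarrow> F m \<in> C"
  shows "x \<in> C"
proof (rule ccontr)
  assume "x \<notin> C"
  then obtain \<phi> :: "'b \<Rightarrow> real" where \<phi>: "bounded_linear \<phi>" "\<And>c. c \<in> C \<Longrightarrow> \<phi> c \<ge> 0" "\<phi> x < 0"
    using separating_functional_closed_cone[OF assms(1-4)] by blast
  have "\<phi> x = (\<integral>m. \<phi> (F m) \<partial>M)"
    using I \<phi>(1) unfolding has_weak_integral_def by (metis has_bochner_integral_integral_eq)
  also have "\<dots> \<ge> 0" by (rule integral_nonneg_AE) (use \<phi>(2) F in auto)
  finally show False using \<phi>(3) by simp
qed

text \<open>Separation from the cone \<open>{0}\<close> shows that functionals distinguish points,
  so the \<open>THE\<close> in \<open>weak_integral\<close> is determined.\<close>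

lemma has_weak_integral_unique:
  fixes x y :: "'b::real_normed_vector"
  assumes "has_weak_integral M F x" and "has_weak_integral M F y"
  shows "x = y"
proof (rule ccontr)
  assume "x \<noteq> y"
  then obtain \<phi> :: "'b \<Rightarrow> real" where \<phi>: "bounded_linear \<phi>" "\<phi> (x - y) < 0"
    using separating_functional_closed_cone[of "{0}" "x - y"] by auto
  have "\<phi> x = \<phi> y"
    using assms \<phi>(1) unfolding has_weak_integral_def by (metis has_bochner_integral_eq)
  with \<phi> show False by (simp add: linear_diff bounded_linear.linear)
qed

lemma weak_integral_eq: "has_weak_integral M F x \<Longrightarrow> weak_integral M F = x"
  unfolding weak_integral_def by (blast intro: has_weak_integral_unique)

lemma has_weak_integral_weak_integral:
  "weakly_integrable M F \<Longrightarrow> has_weak_integral M F (weak_integral M F)"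
  by (auto simp: weakly_integrable_def weak_integral_eq)

lemma has_weak_integral_bounded_linear:
  "has_weak_integral M F x \<Longrightarrow> bounded_linear T \<Longrightarrow> has_weak_integral M (\<lambda>m. T (F m)) (T x)"
  using bounded_linear_compose[of _ T] by (auto simp: has_weak_integral_def)

lemma has_weak_integral_cong:
  "(\<And>m. m \<in> space M \<Longrightarrow> F m = G m) \<Longrightarrow> has_weak_integral M F x \<longleftrightarrow> has_weak_integral M G x"
  unfolding has_weak_integral_def
  by (intro all_cong has_bochner_integral_cong) auto

lemma weak_integral_nonneg:
  assumes "weakly_integrable M F" and "\<And>m. m \<in> space M \<Longrightarrow> 0 \<preceq> F m"
  shows "0 \<preceq> weak_integral M F"
  using has_weak_integral_in_closed_cone[OF closed_cstar_nonneg _ _ _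
      has_weak_integral_weak_integral[OF assms(1)]] assms(2)
  by (auto simp: cstar_nonneg_add cstar_nonneg_scaleR) (simp add: cstar_le_def exI[of _ 0])

section \<open>Adjoints on submodules\<close>

lemma submodule_diff:
  "submodule act S \<Longrightarrow> f \<in> S \<Longrightarrow> g \<in> S \<Longrightarrow> f - g \<in> S"
  unfolding submodule_def by (metis scaleC_minus1 add_uminus_conv_diff)

lemma submodule_act: "submodule act S \<Longrightarrow> f \<in> S \<Longrightarrow> act a f \<in> S"
  by (simp add: submodule_def)

context hilbert_module
begin

lemma ip_add_right: "ip f (g + h) = ip f g + ip f h"
  by (metis ip_star ip_add_left star_add)

lemma ip_scaleC_right: "ip f (c *\<^sub>C g) = cnj c *\<^sub>C ip f g"
  by (metis ip_star ip_scaleC_left star_scaleC)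

lemma ip_diff_right: "ip f (g - h) = ip f g - ip f h"
  using ip_add_right[of f g "- h"] ip_scaleC_right[of f "-1" h] by (simp add: scaleC_minus1)

lemma ip_act_right: "ip f (act a g) = ip f g * star a"
  by (metis ip_star ip_act_left star_mult)

lemma ip_act_act: "ip (act a f) (act a f) = a * ip f f * star a"
  by (simp add: ip_act_left ip_act_right mult.assoc)

lemma norm_ip_self: "norm (ip f f) = (norm f)\<^sup>2"
  by (simp add: norm_eq_sqrt_ip)

text \<open>Testing with \<open>f = u - v\<close> gives the uniqueness behind the \<open>THE\<close>
  in \<open>adjoint_on\<close>.\<close>

lemma eq_if_ip_eq:
  assumes S: "submodule act S" and u: "u \<in> S" and v: "v \<in> S"
    and eq: "\<And>f. f \<in> S \<Longrightarrow> ip f u = ip f v"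
  shows "u = v"
proof -
  have "ip (u - v) (u - v) = 0"
    using eq[OF submodule_diff[OF S u v]] by (simp add: ip_diff_right)
  then show ?thesis using norm_ip_self[of "u - v"] by simp
qed

lemma adjoint_on_eq:
  assumes S: "submodule act S" and "u \<in> S" and "\<And>f. f \<in> S \<Longrightarrow> ip (L f) g = ip f u"
  shows "adjoint_on ip S L g = u"
  unfolding adjoint_on_def
proof (rule the_equality)
  show "v = u" if "v \<in> S \<and> (\<forall>f\<in>S. ip (L f) g = ip f v)" for v
    using that assms by (intro eq_if_ip_eq[OF S]) auto
qed (use assms in auto)

lemma adjoint_on_adjoint:
  assumes S: "submodule act S" and L: "L \<in> End_star act ip S T" and g: "g \<in> T"
  shows "adjoint_on ip S L g \<in> S" and "f \<in> S \<Longrightarrow> ip (L f) g = ip f (adjoint_on ip S L g)"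
proof -
  obtain L' where "\<forall>g\<in>T. L' g \<in> S" "\<forall>f\<in>S. \<forall>g\<in>T. ip (L f) g = ip f (L' g)"
    using L by (auto simp: End_star_def)
  with g have "L' g \<in> S" "\<And>f. f \<in> S \<Longrightarrow> ip (L f) g = ip f (L' g)" by auto
  then show "adjoint_on ip S L g \<in> S" "f \<in> S \<Longrightarrow> ip (L f) g = ip f (adjoint_on ip S L g)"
    using adjoint_on_eq[OF S, of "L' g" L g] by auto
qed

text \<open>\<open>End_star\<close> asks for an adjoint without asking that it be linear; module
  linearity follows from uniqueness.\<close>

lemma adjoint_on_act:
  assumes S: "submodule act S" and L: "L \<in> End_star act ip S T" and g: "g \<in> T"
  shows "adjoint_on ip S L (act a g) = act a (adjoint_on ip S L g)"
  using adjoint_on_adjoint[OF assms] S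
  by (intro adjoint_on_eq) (simp_all add: submodule_act ip_act_right)

lemma End_star_act: "L \<in> End_star act ip S T \<Longrightarrow> f \<in> S \<Longrightarrow> L (act a f) = act a (L f)"
  by (simp add: End_star_def)

text \<open>Sending \<open>b\<close> to \<open>a * b * star a\<close> is bounded and linear, so it
  passes through the weak integral.\<close>

lemma weak_integral_ip_act:
  assumes U: "submodule act U" and L: "\<And>m. m \<in> space M \<Longrightarrow> \<Lambda> m \<in> End_star act ip U (W m)"
    and f: "f \<in> U" and int: "weakly_integrable M (\<lambda>m. ip (\<Lambda> m f) (\<Lambda> m f))"
  shows "weak_integral M (\<lambda>m. ip (\<Lambda> m (act a f)) (\<Lambda> m (act a f)))
    = a * weak_integral M (\<lambda>m. ip (\<Lambda> m f) (\<Lambda> m f)) * star a"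
proof (rule weak_integral_eq)
  have "has_weak_integral M (\<lambda>m. a * ip (\<Lambda> m f) (\<Lambda> m f) * star a)
      (a * weak_integral M (\<lambda>m. ip (\<Lambda> m f) (\<Lambda> m f)) * star a)"
    by (rule has_weak_integral_bounded_linear[OF has_weak_integral_weak_integral[OF int]])
       (intro bounded_linear_mult_const bounded_linear_const_mult bounded_linear_ident)
  moreover have "ip (\<Lambda> m (act a f)) (\<Lambda> m (act a f)) = a * ip (\<Lambda> m f) (\<Lambda> m f) * star a"
    if "m \<in> space M" for m
    by (simp only: End_star_act[OF L[OF that] f] ip_act_act)
  ultimately show "has_weak_integral M (\<lambda>m. ip (\<Lambda> m (act a f)) (\<Lambda> m (act a f)))
      (a * weak_integral M (\<lambda>m. ip (\<Lambda> m f) (\<Lambda> m f)) * star a)"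
    by (simp cong: has_weak_integral_cong)
qed

end

section \<open>Order and norm forms of the frame bounds\<close>

theorem theorem2p13:
  fixes act :: "'a::cstar_algebra \<Rightarrow> 'x::{complex_normed_vector,banach} \<Rightarrow> 'x"
    and ip :: "'x \<Rightarrow> 'x \<Rightarrow> 'a"
    and U V :: "'x set"
    and M :: "'m measure"
    and W :: "'m \<Rightarrow> 'x set"
    and K :: "'x \<Rightarrow> 'x"
    and \<Lambda> :: "'m \<Rightarrow> 'x \<Rightarrow> 'x"
    and Tstar :: "'x \<Rightarrow> 'm \<Rightarrow> 'x"
  assumes "hilbert_module act ip"
    and "submodule act U" and "closed U"
    and "submodule act V" and "closed V"
    and "\<And>m. m \<in> space M \<Longrightarrow> submodule act (W m) \<and> W m \<subseteq> V"
    and "K \<in> End_star act ip U U"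
    and "\<And>m. m \<in> space M \<Longrightarrow> \<Lambda> m \<in> End_star act ip U (W m)"
    and "\<And>f. f \<in> U \<Longrightarrow> (\<lambda>m. ip f (\<Lambda> m f)) \<in> borel_measurable M"
    and "Tstar = (\<lambda>f m. \<Lambda> m f)"
    and "\<And>f. f \<in> U \<Longrightarrow> Tstar f \<in> hsum ip M W"
    and "orth_complemented ip M W (hsum_closure ip M W (Tstar ` U))"
  shows "cKg_frame act ip M U W K \<Lambda> \<longleftrightarrow>
    (\<exists>A>0. \<exists>B>0. \<forall>f\<in>U.
      A * (norm (adjoint_on ip U K f))\<^sup>2
        \<le> norm (weak_integral M (\<lambda>m. ip (\<Lambda> m f) (\<Lambda> m f))) \<and>
      norm (weak_integral M (\<lambda>m. ip (\<Lambda> m f) (\<Lambda> m f))) \<le> B * (norm f)\<^sup>2)"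
proof -
  interpret hilbert_module act ip by fact
  define k where "k f = adjoint_on ip U K f" for f
  define J where "J f = weak_integral M (\<lambda>m. ip (\<Lambda> m f) (\<Lambda> m f))" for f
  have int: "weakly_integrable M (\<lambda>m. ip (\<Lambda> m f) (\<Lambda> m f))" if "f \<in> U" for f
    using assms(10) assms(11)[OF that] by (simp add: hsum_def)
  have J_nonneg: "0 \<preceq> J f" if "f \<in> U" for f
    unfolding J_def using ip_nonneg by (intro weak_integral_nonneg int that)
  have J_act: "J (act a f) = a * J f * star a" if "f \<in> U" for a f
    unfolding J_def by (rule weak_integral_ip_act[OF assms(2,8) that int[OF that]])
  have k_act: "k (act a f) = act a (k f)" if "f \<in> U" for a f
    unfolding k_def by (rule adjoint_on_act[OF assms(2,7) that])
  have act_U: "act a f \<in> U" if "f \<in> U" for a f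
    by (rule submodule_act[OF assms(2) that])
  \<comment> \<open>The same \<open>A\<close> and \<open>B\<close> serve in both conditions.\<close>
  have "(\<forall>f\<in>U. A *\<^sub>R ip (k f) (k f) \<preceq> J f \<and> J f \<preceq> B *\<^sub>R ip f f) \<longleftrightarrow>
      (\<forall>f\<in>U. A * (norm (k f))\<^sup>2 \<le> norm (J f) \<and> norm (J f) \<le> B * (norm f)\<^sup>2)"
    if A: "A > 0" and B: "B > 0" for A B
  proof (intro iffI ballI conjI)
    fix f
    assume fr: "\<forall>f\<in>U. A *\<^sub>R ip (k f) (k f) \<preceq> J f \<and> J f \<preceq> B *\<^sub>R ip f f" and f: "f \<in> U"
    show "A * (norm (k f))\<^sup>2 \<le> norm (J f)"
      using cstar_norm_mono[OF cstar_nonneg_scaleR[OF ip_nonneg], of A "k f" "J f"] fr f A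
      by (simp add: norm_ip_self)
    show "norm (J f) \<le> B * (norm f)\<^sup>2"
      using cstar_norm_mono[OF J_nonneg[OF f], of "B *\<^sub>R ip f f"] fr f B
      by (simp add: norm_ip_self)
  next
    fix f
    assume f: "f \<in> U"
      and le: "\<forall>f\<in>U. A * (norm (k f))\<^sup>2 \<le> norm (J f) \<and> norm (J f) \<le> B * (norm f)\<^sup>2"
    \<comment> \<open>The norm bound at \<open>act a f\<close> is the bound conjugated by
      \<open>a\<close> that \<open>cstar_le_if_norm_le\<close> asks for.\<close>
    show "J f \<preceq> B *\<^sub>R ip f f"
    proof (rule cstar_le_if_norm_le[OF ip_nonneg J_nonneg[OF f]])
      show "norm (a * J f * star a) \<le> B * norm (a * ip f f * star a)" for a
        using le[rule_format, OF act_U[OF f, of a]]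
        by (simp add: J_act[OF f] norm_ip_self flip: ip_act_act)
    qed (use B in simp)
    \<comment> \<open>The comparison puts the constant on the larger side, hence
      \<open>1 / A\<close>; multiplying by \<open>A\<close> restores the frame form.\<close>
    have "ip (k f) (k f) \<preceq> (1 / A) *\<^sub>R J f"
    proof (rule cstar_le_if_norm_le[OF J_nonneg[OF f] ip_nonneg])
      show "norm (a * ip (k f) (k f) * star a) \<le> 1 / A * norm (a * J f * star a)" for a
        using le[rule_format, OF act_U[OF f, of a]] A
        by (simp add: J_act[OF f] k_act[OF f] norm_ip_self pos_le_divide_eq mult.commute flip: ip_act_act)
    qed (use A in simp)
    then have "0 \<preceq> A *\<^sub>R ((1 / A) *\<^sub>R J f - ip (k f) (k f))"
      using A by (intro cstar_nonneg_scaleR) (simp_all add: cstar_le_iff[of "ip (k f) (k f)"])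
    then show "A *\<^sub>R ip (k f) (k f) \<preceq> J f"
      using A by (simp add: cstar_le_iff[of "A *\<^sub>R ip (k f) (k f)"] scaleR_diff_right)
  qed
  then have "(\<exists>A>0. \<exists>B>0. \<forall>f\<in>U. A *\<^sub>R ip (k f) (k f) \<preceq> J f \<and> J f \<preceq> B *\<^sub>R ip f f) \<longleftrightarrow>
      (\<exists>A>0. \<exists>B>0. \<forall>f\<in>U. A * (norm (k f))\<^sup>2 \<le> norm (J f) \<and> norm (J f) \<le> B * (norm f)\<^sup>2)"
    by (simp cong: conj_cong)
  then show ?thesis
    unfolding cKg_frame_def k_def J_def using assms(8,9) int by simp
qed

end
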